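(* For all integers $m\ge 1$ and $N\ge 0$, the one-point correlator of the $q$-deformed Hermitian Gaussian matrix model of size $N$ is given, as an identity in $\mathbb{Q}(q)$, by $$\big\langle \mathrm{tr}\,X^{2m}\big\rangle_q \;=\; q^{-2Nm}\,B_m+\sum_{a=0}^{m} q^{2Na}\,A_{m,a},$$ where, for $0\le a\le m$, $$A_{m,a}=[2m-1]!!\;q^{m-2a}\;\frac{\prod_{n=1}^{m}\left(q^{2n}+q^{-2a}\right)}{\left(q^{2m}-q^{-2a}\right)\prod_{0\le n\le m,\; n\ne a}\left(1-q^{2n-2a}\right)},$$ $$B_m=[2m-1]!!\;q^{m}\;\frac{\prod_{n=1}^{m}\left(q^{2n}+q^{2m}\right)}{\prod_{n=0}^{m}\left(1-q^{2n+2m}\right)} .$$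
   Context: Let $q$ be an indeterminate. The $q$-numbers are $[n]=\frac{q^{-n}-q^{n}}{q^{-1}-q}$, and $[2m-1]!!=[1][3][5]\cdots[2m-1]$. Let $\Lambda$ be the ring of symmetric functions over $\mathbb{Q}(q)$, viewed as the polynomial ring $\mathbb{Q}(q)[p_1,p_2,\dots]$ in the power sums, and let $\chi_R\in\Lambda$ denote the Schur function of the partition $R$. For a sequence $(a_k)_{k\ge1}$ of scalars, $\chi_R(a_k)$ denotes the value of $\chi_R$ under the substitution $p_k\mapsto a_k$ for all $k\geq 1$. Define the following specializations. - For $n=1,2$: $\delta_{k|n}=n\,\frac{(q^{-1}-q)^{k/n}}{q^{-k}-q^{k}}$ if $n$ divides $k$, and $\delta_{k|n}=0$ otherwise. - For an integer $N\ge 0$: $p_k^{*}=\frac{q^{-Nk}-q^{Nk}}{q^{-k}-q^{k}}$. For each integer $N\ge 0$, the average $\langle\,\cdot\,\rangle_q$ of the $q$-deformed Hermitian Gaussian matrix model of size $N$ is the $\mathbb{Q}(q)$-linear functional on $\Lambda$ determined on the Schur basis by $$\langle \chi_R\rangle_q=\frac{\chi_R(\delta_{k|2})}{\chi_R(\delta_{k|1})}\;\chi_R(p_k^{*})\qquad\text{for every partition } R .$$ The symbol $\mathrm{tr}\,X^{j}$ denotes the power sum $p_j\in\Lambda$ (in terms of eigenvalues, $x_1^j+\dots+x_N^j$). The dependence of $\langle\,\cdot\,\rangle_q$ on $N$ enters only through $p_k^{*}$. *)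

theory Defs
  imports
    "HOL-Library.Poly_Mapping"
    "HOL-Computational_Algebra.Computational_Algebra"
    "Jordan_Normal_Form.Determinant"
begin

section \<open>The field of rational functions and q-numbers\<close>

type_synonym ratfun = "rat poly fract"

definition qv :: ratfun where
  "qv = Fract [:0, 1:] 1"

definition qnum :: "int \<Rightarrow> ratfun" where
  "qnum n = (qv powi (- n) - qv powi n) / (inverse qv - qv)"

definition qdfact_odd :: "nat \<Rightarrow> ratfun" where
  "qdfact_odd m = (\<Prod>j = 1..m. qnum (2 * int j - 1))"


section \<open>Symmetric functions as polynomials in the power sums\<close>

text \<open>Finitely supported functions on exponent vectors. The variable with index \<open>i\<close> is
  the power sum \<open>p\<^sub>i\<^sub>+\<^sub>1\<close>, so that there is no spurious variable \<open>p\<^sub>0\<close>.\<close>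

type_synonym symfun = "(nat \<Rightarrow>\<^sub>0 nat) \<Rightarrow>\<^sub>0 ratfun"

definition sconst :: "ratfun \<Rightarrow> symfun" where
  "sconst c = Poly_Mapping.single 0 c"

definition sscale :: "ratfun \<Rightarrow> symfun \<Rightarrow> symfun" where
  "sscale c f = sconst c * f"

text \<open>Only meaningful for \<open>k \<ge> 1\<close>.\<close>

definition powersum :: "nat \<Rightarrow> symfun" where
  "powersum k = Poly_Mapping.single (Poly_Mapping.single (k - 1) 1) 1"

text \<open>The value of \<open>f\<close> under the substitution \<open>p\<^sub>k \<mapsto> a k\<close> for all \<open>k \<ge> 1\<close>.\<close>

definition specialize :: "(nat \<Rightarrow> ratfun) \<Rightarrow> symfun \<Rightarrow> ratfun" where
  "specialize a f = (\<Sum>e \<in> Poly_Mapping.keys f. Poly_Mapping.lookup f e *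
     (\<Prod>i \<in> Poly_Mapping.keys e. a (Suc i) ^ Poly_Mapping.lookup e i))"

text \<open>Complete homogeneous functions, from the generating function
  \<open>\<Sum>n. h\<^sub>n z\<^sup>n = exp (\<Sum>k\<ge>1. p\<^sub>k z\<^sup>k / k)\<close>. The exponential series is written out because
  \<open>fps_exp\<close> requires coefficients in a field.\<close>

definition complete_gf :: "symfun fps" where
  "complete_gf =
     fps_compose (Abs_fps (\<lambda>j. sconst (1 / of_nat (fact j))))
       (Abs_fps (\<lambda>k. if k = 0 then 0 else sscale (1 / of_nat k) (powersum k)))"

definition complete_sym :: "int \<Rightarrow> symfun" where
  "complete_sym n = (if n < 0 then 0 else fps_nth complete_gf (nat n))"

definition is_partition :: "nat list \<Rightarrow> bool" where
  "is_partition R \<longleftrightarrow> sorted_wrt (\<ge>) R \<and> 0 \<notin> set R"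

text \<open>The Jacobi--Trudi determinant \<open>det (h (R\<^sub>i - i + j))\<close>.\<close>

definition schur :: "nat list \<Rightarrow> symfun" where
  "schur R = det (mat (length R) (length R)
     (\<lambda>(i, j). complete_sym (int (R ! i) - int i + int j)))"


section \<open>The q-deformed Gaussian average\<close>

text \<open>Used for \<open>n = 1, 2\<close> only.\<close>

definition delta_spec :: "nat \<Rightarrow> nat \<Rightarrow> ratfun" where
  "delta_spec n k =
     (if n dvd k
      then of_nat n * ((inverse qv - qv) ^ (k div n) / (qv powi (- int k) - qv powi int k))
      else 0)"

definition pstar :: "nat \<Rightarrow> nat \<Rightarrow> ratfun" where
  "pstar N k = (qv powi (- (int N * int k)) - qv powi (int N * int k))
     / (qv powi (- int k) - qv powi int k)"

definition is_q_gaussian_average :: "nat \<Rightarrow> (symfun \<Rightarrow> ratfun) \<Rightarrow> bool" where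
  "is_q_gaussian_average N E \<longleftrightarrow>
     Vector_Spaces.linear sscale (*) E \<and>
     (\<forall>R. is_partition R \<longrightarrow>
        E (schur R) =
          specialize (delta_spec 2) (schur R) / specialize (delta_spec 1) (schur R)
            * specialize (pstar N) (schur R))"

text \<open>\<open>linear\<close> includes the vector space axioms for both scalings; the following shows that
  these hold, so the predicate above asks for nothing but linearity and the values on Schur
  functions.\<close>

lemma vector_space_sscale: "vector_space sscale"
  by unfold_locales
    (simp_all add: sscale_def sconst_def algebra_simps mult_single single_add
      flip: mult.assoc single_one)

lemma vector_space_ratfun: "vector_space ((*) :: ratfun \<Rightarrow> _)"
  by unfold_locales (simp_all add: algebra_simps)


section \<open>The coefficients of the one-point correlator\<close>

definition coeffA :: "nat \<Rightarrow> nat \<Rightarrow> ratfun" where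
  "coeffA m a =
     qdfact_odd m * qv powi (int m - 2 * int a) *
     ((\<Prod>n = 1..m. qv ^ (2 * n) + qv powi (- 2 * int a)) /
      ((qv ^ (2 * m) - qv powi (- 2 * int a)) *
       (\<Prod>n \<in> {0..m} - {a}. 1 - qv powi (2 * int n - 2 * int a))))"

definition coeffB :: "nat \<Rightarrow> ratfun" where
  "coeffB m =
     qdfact_odd m * qv ^ m *
     ((\<Prod>n = 1..m. qv ^ (2 * n) + qv ^ (2 * m)) /
      (\<Prod>n = 0..m. 1 - qv ^ (2 * n + 2 * m)))"

end

theory Submission
  imports Defs
begin

text \<open>
  The power sum \<open>p\<^sub>2\<^sub>m\<close> is the alternating sum of the hook Schur functions of size \<open>2 m\<close>. Under each of
  the three specializations the generating function \<open>H\<close> of the complete functions satisfies a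
  first-order q-difference equation \<open>H(z/q) U(z) = H(q z) V(z)\<close>, so that hooks specialize to products
  of q-numbers. Pairing the hooks of leg lengths \<open>2 b\<close> and \<open>2 b + 1\<close> gives a sum over \<open>b < m\<close> whose
  summands depend on \<open>N\<close> only through products of \<open>2 m\<close> consecutive q-numbers beginning at
  \<open>[N - 2 b]\<close> and \<open>[N - 2 b - 1]\<close>. Expanding these products with the q-binomial theorem in base \<open>q\<^sup>2\<close>
  separates \<open>q\<^bsup>2 N (j - m)\<^esup>\<close> from \<open>b\<close>, and the remaining sum over \<open>b\<close> is again a q-binomial sum, in
  base \<open>q\<^sup>4\<close>. Up to a factor free of \<open>j\<close>, its value is \<open>\<Prod>i<m-1. 1 - q\<^bsup>4(i+1-j)\<^esup>\<close>, which vanishes for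
  \<open>0 < j < m\<close>; the term \<open>j = 0\<close> is \<open>B\<^sub>m\<close> and the term \<open>j = m + a\<close> is \<open>A\<^sub>m\<^sub>,\<^sub>a\<close>.
\<close>

section \<open>Specialization is a ring homomorphism\<close>

definition eval_monom :: "(nat \<Rightarrow> ratfun) \<Rightarrow> (nat \<Rightarrow>\<^sub>0 nat) \<Rightarrow> ratfun" where
  "eval_monom a e = (\<Prod>i \<in> Poly_Mapping.keys e. a (Suc i) ^ Poly_Mapping.lookup e i)"

text \<open>Indices outside the support contribute a zeroth power, so monomials with different
  supports can be evaluated over a common index set.\<close>

lemma eval_monom_superset:
  assumes "finite S" "Poly_Mapping.keys e \<subseteq> S"
  shows "eval_monom a e = (\<Prod>i\<in>S. a (Suc i) ^ Poly_Mapping.lookup e i)"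
  unfolding eval_monom_def using assms
  by (intro prod.mono_neutral_left) (auto simp: in_keys_iff)

lemma eval_monom_add: "eval_monom a (e + e') = eval_monom a e * eval_monom a e'"
proof -
  let ?S = "Poly_Mapping.keys e \<union> Poly_Mapping.keys e'"
  have "eval_monom a (e + e') = (\<Prod>i\<in>?S. a (Suc i) ^ Poly_Mapping.lookup (e + e') i)"
    by (intro eval_monom_superset) (use keys_add[of e e'] in auto)
  then show ?thesis
    by (simp add: eval_monom_superset[of ?S e] eval_monom_superset[of ?S e'] lookup_add power_add
        prod.distrib)
qed

lemma specialize_superset:
  assumes "finite S" "Poly_Mapping.keys f \<subseteq> S"
  shows "specialize a f = (\<Sum>e\<in>S. Poly_Mapping.lookup f e * eval_monom a e)"
  unfolding specialize_def eval_monom_def[symmetric] using assms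
  by (intro sum.mono_neutral_left) (auto simp: in_keys_iff)

lemma specialize_add: "specialize a (f + g) = specialize a f + specialize a g"
proof -
  let ?S = "Poly_Mapping.keys f \<union> Poly_Mapping.keys g"
  have "specialize a (f + g) = (\<Sum>e\<in>?S. Poly_Mapping.lookup (f + g) e * eval_monom a e)"
    by (intro specialize_superset) (use keys_add[of f g] in auto)
  then show ?thesis
    by (simp add: specialize_superset[of ?S f] specialize_superset[of ?S g] lookup_add ring_distribs
        sum.distrib)
qed

lemma specialize_single: "specialize a (Poly_Mapping.single e c) = c * eval_monom a e"
  by (subst specialize_superset[of "{e}"]) auto

lemma specialize_0 [simp]: "specialize a 0 = 0"
  by (simp add: specialize_def)

lemma specialize_1 [simp]: "specialize a 1 = 1"
  by (simp add: specialize_single eval_monom_def flip: single_one)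

lemma specialize_sum: "specialize a (sum f A) = (\<Sum>x\<in>A. specialize a (f x))"
  by (induction A rule: infinite_finite_induct) (simp_all add: specialize_add)

lemma specialize_minus: "specialize a (- f) = - specialize a f"
  using specialize_add[of a f "- f"] by (simp add: add_eq_0_iff)

lemma specialize_diff: "specialize a (f - g) = specialize a f - specialize a g"
  using specialize_add[of a f "- g"] by (simp add: specialize_minus)

text \<open>Dropping the freshness of the key in \<open>update_induct\<close> turns the step into
  plain addition of a monomial, to which additivity and distributivity apply directly.\<close>

lemma poly_mapping_single_add_induct [case_names zero single_add]:
  fixes P :: "('a \<Rightarrow>\<^sub>0 'b::comm_monoid_add) \<Rightarrow> bool"
  assumes "P 0" and "\<And>k v f. P f \<Longrightarrow> P (Poly_Mapping.single k v + f)"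
  shows "P f"
proof (induction f rule: update_induct)
  case const
  then show ?case by (simp add: assms)
next
  case (update f k v)
  have "Poly_Mapping.update k v f = Poly_Mapping.single k v + f"
    using update(1)
    by (intro poly_mapping_eqI) (auto simp: lookup_update lookup_add lookup_single in_keys_iff)
  then show ?case using assms(2) update by simp
qed

text \<open>Additivity in both arguments reduces the claim to two monomials, where it is
  \<open>eval_monom_add\<close>; hence the nested induction.\<close>

lemma specialize_mult: "specialize a (f * g) = specialize a f * specialize a g"
proof (induction f rule: poly_mapping_single_add_induct)
  case zero
  then show ?case by simp
next
  case (single_add k v f)
  have "specialize a (Poly_Mapping.single k v * g) = v * eval_monom a k * specialize a g"
  proof (induction g rule: poly_mapping_single_add_induct)
    case zero
    then show ?case by simp
  next
    case (single_add k v f)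
    then show ?case
      by (simp add: ring_distribs specialize_add mult_single specialize_single eval_monom_add)
  qed
  with single_add show ?case
    by (simp add: ring_distribs specialize_add specialize_single)
qed

lemma specialize_power: "specialize a (f ^ n) = specialize a f ^ n"
  by (induction n) (simp_all add: specialize_mult)

lemma specialize_of_nat: "specialize a (of_nat n) = of_nat n"
  by (induction n) (simp_all add: specialize_add)

lemma specialize_powersum:
  assumes "k \<ge> 1"
  shows "specialize a (powersum k) = a k"
  using assms by (simp add: powersum_def specialize_single eval_monom_def)

section \<open>Newton's identities\<close>

lemma of_nat_ratfun_neq_0: "n \<noteq> 0 \<Longrightarrow> (of_nat n :: ratfun) \<noteq> 0"
  by (simp add: of_nat_fract Zero_fract_def eq_fract)

lemma sconst_mult: "sconst c * sconst d = sconst (c * d)"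
  by (simp add: sconst_def mult_single)

lemma of_nat_symfun: "of_nat n = sconst (of_nat n)"
  by (simp add: sconst_def single_of_nat)

text \<open>Since H = exp(P) with P = sum p_k z^k / k, the chain rule gives H' = H P'.
  Coefficientwise these are Newton's identities.\<close>

lemma fps_deriv_complete_gf:
  "fps_deriv complete_gf = complete_gf * Abs_fps (\<lambda>k. powersum (Suc k))"
proof -
  let ?E = "Abs_fps (\<lambda>j. sconst (1 / of_nat (fact j)))"
  let ?P = "Abs_fps (\<lambda>k. if k = 0 then 0 else sscale (1 / of_nat k) (powersum k))"
  have "fps_deriv ?E = ?E"
  proof (rule fps_ext)
    fix n
    have "of_nat (fact (Suc n)) = (of_nat (Suc n) * of_nat (fact n) :: ratfun)"
      by (simp only: fact_Suc of_nat_mult of_nat_id)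
    then have "(of_nat (Suc n) :: ratfun) * (1 / of_nat (fact (Suc n))) = 1 / of_nat (fact n)"
      using of_nat_ratfun_neq_0[of "Suc n"] of_nat_ratfun_neq_0[of "fact n"]
      by (simp del: of_nat_Suc fact_Suc)
    then show "fps_nth (fps_deriv ?E) n = fps_nth ?E n"
      by (simp add: of_nat_symfun sconst_mult del: of_nat_Suc fact_Suc)
  qed
  moreover have "fps_deriv ?P = Abs_fps (\<lambda>k. powersum (Suc k))"
  proof (rule fps_ext)
    fix n
    have "sconst (of_nat (Suc n)) * sconst (1 / of_nat (Suc n)) = 1"
      unfolding sconst_mult using of_nat_ratfun_neq_0[of "Suc n"]
      by (simp add: sconst_def flip: single_one del: of_nat_Suc)
    then show "fps_nth (fps_deriv ?P) n = fps_nth (Abs_fps (\<lambda>k. powersum (Suc k))) n"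
      by (simp add: of_nat_symfun sscale_def mult.assoc[symmetric] del: of_nat_Suc)
  qed
  ultimately show ?thesis
    unfolding complete_gf_def by (subst fps_compose_deriv) auto
qed

lemma complete_gf_nth_0: "fps_nth complete_gf 0 = 1"
  by (simp add: complete_gf_def sconst_def flip: single_one)

lemma complete_sym_0 [simp]: "complete_sym 0 = 1"
  by (simp add: complete_sym_def complete_gf_nth_0)

lemma complete_sym_neg [simp]: "n < 0 \<Longrightarrow> complete_sym n = 0"
  by (simp add: complete_sym_def)

section \<open>Hook Schur functions\<close>

text \<open>The arguments are row length and leg length rather than Frobenius coordinates, so the
  size is \<open>a + b\<close>.\<close>

definition hook :: "nat \<Rightarrow> nat \<Rightarrow> symfun" where
  "hook a b = schur (a # replicate b 1)"

definition elem_sym :: "nat \<Rightarrow> symfun" where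
  "elem_sym b = schur (replicate b 1)"

lemma is_partition_hook: "a \<ge> 1 \<Longrightarrow> is_partition (a # replicate b 1)"
  by (induction b) (auto simp: is_partition_def)

lemma elem_sym_0 [simp]: "elem_sym 0 = 1"
  by (simp add: elem_sym_def schur_def)

lemma elem_sym_Suc: "elem_sym (Suc b) = hook 1 b"
  by (simp add: elem_sym_def hook_def)

lemma hook_0: "hook a 0 = complete_sym (int a)"
  unfolding hook_def schur_def by (subst det_single) auto

text \<open>Laplace expansion of the Jacobi-Trudi determinant along its first column, which has only
  two nonzero entries. This is the Pieri rule for h_a e_{b+1}, solved for one of its two
  hooks.\<close>

lemma hook_Suc: "hook a (Suc b) = complete_sym (int a) * elem_sym (Suc b) - hook (Suc a) b"
proof -
  let ?R = "a # replicate (Suc b) 1"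
  define M where "M = mat (length ?R) (length ?R)
     (\<lambda>(i, j). complete_sym (int (?R ! i) - int i + int j))"
  have M: "M \<in> carrier_mat (Suc (Suc b)) (Suc (Suc b))"
    by (simp add: M_def)
  \<comment> \<open>From row 1 on the index is 1 - i, which gives h_0 = 1 once and then negative
    indices, where \<open>complete_sym\<close> is 0.\<close>
  have col: "M $$ (i, 0) = (if i = 0 then complete_sym (int a) else if i = 1 then 1 else 0)"
    if "i < Suc (Suc b)" for i
    using that by (auto simp: M_def nth_Cons split: nat.splits)
  have "mat_delete M 0 0 =
      mat (length (replicate (Suc b) (1::nat))) (length (replicate (Suc b) (1::nat)))
     (\<lambda>(i, j). complete_sym (int (replicate (Suc b) 1 ! i) - int i + int j))"
    by (rule eq_matI)
       (simp_all add: mat_delete_def M_def nth_replicate algebra_simps del: replicate_Suc)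
  then have d0: "det (mat_delete M 0 0) = elem_sym (Suc b)"
    by (simp only: elem_sym_def schur_def)
  \<comment> \<open>Losing column 0 raises the indices in the top row by one, so the minor belongs
    to first row \<open>Suc a\<close>; in the rows below, the shifts of row and column
    cancel.\<close>
  have "mat_delete M 1 0 = mat (length (Suc a # replicate b 1)) (length (Suc a # replicate b 1))
     (\<lambda>(i, j). complete_sym (int ((Suc a # replicate b 1) ! i) - int i + int j))"
    by (rule eq_matI)
       (auto simp: mat_delete_def M_def nth_Cons algebra_simps split: nat.splits)
  then have d1: "det (mat_delete M 1 0) = hook (Suc a) b"
    by (simp only: hook_def schur_def)
  have "hook a (Suc b) = det M"
    by (simp only: hook_def schur_def M_def)
  also have "\<dots> = (\<Sum>i<Suc (Suc b). M $$ (i, 0) * cofactor M i 0)"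
    using M by (rule laplace_expansion_column) simp
  also have "\<dots> = (\<Sum>i\<in>{0, 1}. M $$ (i, 0) * cofactor M i 0)"
    by (rule sum.mono_neutral_right) (auto simp: col)
  also have "\<dots> = complete_sym (int a) * elem_sym (Suc b) - hook (Suc a) b"
    using d0 d1 by (simp add: col cofactor_def)
  finally show ?thesis .
qed

text \<open>Iterating \<open>hook_Suc\<close> moves boxes from the leg into the row until no leg is
  left.\<close>

lemma hook_conv_sum:
  "hook a b = (\<Sum>i\<le>b. (-1) ^ i * complete_sym (int (a + i)) * elem_sym (b - i))"
proof (induction b arbitrary: a)
  case 0
  then show ?case by (simp add: hook_0)
next
  case (Suc b)
  have "(\<Sum>i\<le>Suc b. (-1) ^ i * complete_sym (int (a + i)) * elem_sym (Suc b - i))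
      = complete_sym (int a) * elem_sym (Suc b)
        - (\<Sum>i\<le>b. (-1) ^ i * complete_sym (int (Suc a + i)) * elem_sym (b - i))"
    by (subst sum.atMost_Suc_shift) (simp add: sum_negf[symmetric])
  then show ?case
    by (simp only: hook_Suc Suc.IH)
qed

section \<open>Generating functions and the hook expansion of power sums\<close>

definition complete_fps :: "symfun fps" where
  "complete_fps = Abs_fps (\<lambda>n. complete_sym (int n))"

definition signed_elem_fps :: "symfun fps" where
  "signed_elem_fps = Abs_fps (\<lambda>n. (-1) ^ n * elem_sym n)"

text \<open>In degree k + 1 the h_0 term is, up to sign, e_{k+1}; the others expand the hook with
  row 1 and leg k with the opposite sign. That hook is the same column, so everything
  cancels.\<close>

lemma complete_mult_signed_elem: "complete_fps * signed_elem_fps = 1"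
proof (rule fps_ext)
  fix n
  show "fps_nth (complete_fps * signed_elem_fps) n = fps_nth 1 n"
  proof (cases n)
    case 0
    then show ?thesis by (simp add: complete_fps_def signed_elem_fps_def)
  next
    case (Suc k)
    have "fps_nth (complete_fps * signed_elem_fps) n
        = (\<Sum>i\<le>Suc k. complete_sym (int i) * ((-1) ^ (Suc k - i) * elem_sym (Suc k - i)))"
      by (simp add: Suc complete_fps_def signed_elem_fps_def fps_mult_nth atLeast0AtMost
          del: sum.atMost_Suc)
    also have "\<dots> = (-1) ^ Suc k
        * (\<Sum>i\<le>Suc k. (-1) ^ i * complete_sym (int i) * elem_sym (Suc k - i))"
      unfolding sum_distrib_left
    proof (rule sum.cong[OF refl])
      fix i assume "i \<in> {..Suc k}"
      then have "(-1 :: symfun) ^ (Suc k - i) = (-1) ^ Suc k * (-1) ^ i"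
        by (subst power_add[symmetric]) (auto simp: minus_one_power_iff)
      then show "complete_sym (int i) * ((-1) ^ (Suc k - i) * elem_sym (Suc k - i))
          = (-1) ^ Suc k * ((-1) ^ i * complete_sym (int i) * elem_sym (Suc k - i))"
        by (simp only: mult_ac)
    qed
    also have "\<dots> = (-1) ^ Suc k * (elem_sym (Suc k) - hook 1 k)"
      unfolding hook_conv_sum[of 1 k]
      by (subst sum.atMost_Suc_shift) (simp add: sum_negf[symmetric])
    finally show ?thesis by (simp add: Suc elem_sym_Suc)
  qed
qed

lemma fps_deriv_complete_fps:
  "fps_deriv complete_fps = Abs_fps (\<lambda>k. powersum (Suc k)) * complete_fps"
proof -
  have "complete_fps = complete_gf"
    by (rule fps_ext) (simp add: complete_fps_def complete_sym_def)
  then show ?thesis by (simp add: fps_deriv_complete_gf mult.commute)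
qed

text \<open>Combining H' = P' H with H(z) E(-z) = 1 gives P'(z) = H'(z) E(-z). Its coefficients are
  weighted sums of signed products h_{n+1-c} e_c, and regrouping the weights produces partial sums,
  which are signed hooks by \<open>hook_conv_sum\<close>.\<close>

lemma powersum_conv_hooks:
  "powersum (Suc n) = (\<Sum>b\<le>n. (-1) ^ b * hook (Suc n - b) b)"
proof -
  define F where "F c = (-1) ^ c * complete_sym (int (Suc n - c)) * elem_sym c" for c
  have hook: "(-1) ^ b * hook (Suc n - b) b = (\<Sum>c\<le>b. F c)" if "b \<le> n" for b
  proof -
    have "(-1) ^ b * hook (Suc n - b) b = (\<Sum>i\<le>b. F (b - i))"
      unfolding hook_conv_sum sum_distrib_left
    proof (rule sum.cong[OF refl])
      fix i assume i: "i \<in> {..b}"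
      then have sg: "(-1 :: symfun) ^ (b - i) = (-1) ^ b * (-1) ^ i"
        by (subst power_add[symmetric]) (auto simp: minus_one_power_iff)
      have "Suc n - b + i = Suc n - (b - i)" using i that by auto
      then show "(-1) ^ b * ((-1) ^ i * complete_sym (int (Suc n - b + i)) * elem_sym (b - i))
          = F (b - i)"
        unfolding F_def sg by (simp only: mult_ac)
    qed
    also have "\<dots> = (\<Sum>c\<le>b. F c)"
      by (rule sum.reindex_bij_witness[of _ "\<lambda>i. b - i" "\<lambda>i. b - i"]) auto
    finally show ?thesis .
  qed
  have "Abs_fps (\<lambda>k. powersum (Suc k)) = fps_deriv complete_fps * signed_elem_fps"
    by (simp add: fps_deriv_complete_fps mult.assoc complete_mult_signed_elem)
  then have "powersum (Suc n) = fps_nth (fps_deriv complete_fps * signed_elem_fps) n"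
    by (metis fps_nth_Abs_fps)
  also have "\<dots> = (\<Sum>c\<le>n. fps_nth (fps_deriv complete_fps) (n - c) * fps_nth signed_elem_fps c)"
    by (subst mult.commute) (simp add: fps_mult_nth atLeast0AtMost mult.commute)
  also have "\<dots> = (\<Sum>c\<le>n. of_nat (Suc n - c) * F c)"
    by (rule sum.cong) (auto simp: F_def complete_fps_def signed_elem_fps_def Suc_diff_le mult_ac
        simp del: of_nat_Suc)
  \<comment> \<open>The weight n + 1 - c counts the b with c <= b <= n. Replacing it by this count
    and swapping the sums leaves partial sums over c <= b.\<close>
  also have "\<dots> = (\<Sum>c\<le>n. \<Sum>b\<in>{b. b \<le> n \<and> c \<le> b}. F c)"
  proof (rule sum.cong[OF refl])
    fix c
    have "{b. b \<le> n \<and> c \<le> b} = {c..n}" by auto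
    then show "of_nat (Suc n - c) * F c = (\<Sum>b\<in>{b. b \<le> n \<and> c \<le> b}. F c)" by simp
  qed
  also have "\<dots> = (\<Sum>b\<le>n. \<Sum>c\<in>{c. c \<le> n \<and> c \<le> b}. F c)"
    using sum.swap_restrict[of "{..n}" "{..n}" "\<lambda>c b. F c" "\<lambda>c b. c \<le> b"] by simp
  also have "\<dots> = (\<Sum>b\<le>n. (-1) ^ b * hook (Suc n - b) b)"
  proof (rule sum.cong[OF refl])
    fix b assume b: "b \<in> {..n}"
    then have "{c. c \<le> n \<and> c \<le> b} = {..b}" by auto
    with b show "(\<Sum>c\<in>{c. c \<le> n \<and> c \<le> b}. F c) = (-1) ^ b * hook (Suc n - b) b"
      by (simp add: hook)
  qed
  finally show ?thesis .
qed

section \<open>q-difference equations\<close>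

text \<open>Comparing coefficients of z^n expresses (n + 1) W_{n+1} through earlier coefficients, so
  the constant term determines the solution.\<close>

lemma fps_ode_unique:
  fixes W1 W2 B :: "ratfun fps"
  assumes "fps_deriv W1 = B * W1" "fps_deriv W2 = B * W2" "fps_nth W1 0 = fps_nth W2 0"
  shows "W1 = W2"
proof -
  have rec: "of_nat (Suc n) * fps_nth W (Suc n) = (\<Sum>k=0..n. fps_nth B k * fps_nth W (n - k))"
    if "fps_deriv W = B * W" for W :: "ratfun fps" and n
    using arg_cong[OF that, of "\<lambda>f. fps_nth f n"] by (simp add: fps_mult_nth del: of_nat_Suc)
  have "fps_nth W1 n = fps_nth W2 n" for n
  proof (induction n rule: less_induct)
    case (less n)
    show ?case
    proof (cases n)
      case 0
      then show ?thesis using assms by simp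
    next
      case (Suc k)
      have "of_nat (Suc k) * fps_nth W1 (Suc k) = of_nat (Suc k) * fps_nth W2 (Suc k)"
        unfolding rec[OF assms(1)] rec[OF assms(2)] using less Suc by (intro sum.cong) auto
      then show ?thesis using of_nat_ratfun_neq_0[of "Suc k"] Suc by simp
    qed
  qed
  then show ?thesis by (simp add: fps_eq_iff)
qed

text \<open>The series f(c z).\<close>

definition fps_dilate :: "'a::comm_ring_1 \<Rightarrow> 'a fps \<Rightarrow> 'a fps" where
  "fps_dilate c f = Abs_fps (\<lambda>n. c ^ n * fps_nth f n)"

lemma fps_dilate_nth [simp]: "fps_nth (fps_dilate c f) n = c ^ n * fps_nth f n"
  by (simp add: fps_dilate_def)

lemma fps_dilate_1 [simp]: "fps_dilate c 1 = 1"
  by (rule fps_ext) simp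

lemma fps_dilate_mult: "fps_dilate c (f * g) = fps_dilate c f * fps_dilate c (g :: 'a::idom fps)"
  unfolding fps_dilate_def fps_compose_linear[symmetric]
  by (rule fps_compose_mult_distrib) simp

lemma fps_deriv_dilate:
  "fps_deriv (fps_dilate c f) = fps_const c * fps_dilate c (fps_deriv f)"
  by (rule fps_ext) (simp add: mult_ac)

text \<open>\<open>A\<close>, \<open>- GU\<close> and \<open>- GV\<close> are the logarithmic
  derivatives of \<open>H\<close>, \<open>U\<close> and \<open>V\<close>. The last hypothesis
  equates those of H(s z) U(z) and H(t z) V(z), so both products solve one linear differential
  equation with the same constant term.\<close>

lemma fps_q_difference:
  fixes H A U V GU GV :: "ratfun fps" and s t :: ratfun
  assumes "fps_deriv H = A * H"
    and "fps_deriv U = - (GU * U)" "fps_deriv V = - (GV * V)" "fps_nth U 0 = fps_nth V 0"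
    and "\<And>n. (s ^ Suc n - t ^ Suc n) * fps_nth A n = fps_nth GU n - fps_nth GV n"
  shows "fps_dilate s H * U = fps_dilate t H * V"
proof (rule fps_ode_unique)
  define B where "B c = fps_const c * fps_dilate c A" for c
  have deriv: "fps_deriv (fps_dilate c H) = B c * fps_dilate c H" for c
    by (simp add: fps_deriv_dilate assms(1) fps_dilate_mult B_def mult.assoc)
  have B: "B s - GU = B t - GV"
    unfolding B_def using assms(5)
    by (intro fps_ext) (simp add: algebra_simps)
  show "fps_deriv (fps_dilate s H * U) = (B s - GU) * (fps_dilate s H * U)"
    by (simp only: fps_deriv_mult deriv assms(2)) (simp add: algebra_simps)
  show "fps_deriv (fps_dilate t H * V) = (B s - GU) * (fps_dilate t H * V)"
    unfolding B by (simp add: deriv assms(3) algebra_simps)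
  show "fps_nth (fps_dilate s H * U) 0 = fps_nth (fps_dilate t H * V) 0"
    using assms(4) by simp
qed

text \<open>Passing to the reciprocal series exchanges the two dilations. With F(z) = E(-z) this
  carries recurrences over from complete to elementary functions.\<close>

lemma fps_q_difference_inverse:
  fixes H F U V :: "'a::idom fps"
  assumes "fps_dilate s H * U = fps_dilate t H * V" "H * F = 1"
  shows "fps_dilate t F * U = fps_dilate s F * V"
proof -
  have inv: "fps_dilate c H * fps_dilate c F = 1" for c
    using arg_cong[OF assms(2), of "fps_dilate c"] by (simp add: fps_dilate_mult)
  have "fps_dilate t F * U = (fps_dilate s H * fps_dilate s F) * (fps_dilate t F * U)"
    by (simp add: inv)
  also have "\<dots> = (fps_dilate s H * U) * (fps_dilate s F * fps_dilate t F)"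
    by (simp only: mult_ac)
  also have "\<dots> = (fps_dilate t H * fps_dilate t F) * (fps_dilate s F * V)"
    unfolding assms(1) by (simp only: mult_ac)
  also have "\<dots> = fps_dilate s F * V" by (simp add: inv)
  finally show ?thesis .
qed

section \<open>Specialized complete, elementary and hook functions and their recurrences\<close>

definition spec_complete :: "(nat \<Rightarrow> ratfun) \<Rightarrow> nat \<Rightarrow> ratfun" where
  "spec_complete x n = specialize x (complete_sym (int n))"

definition spec_elem :: "(nat \<Rightarrow> ratfun) \<Rightarrow> nat \<Rightarrow> ratfun" where
  "spec_elem x n = specialize x (elem_sym n)"

definition spec_hook :: "(nat \<Rightarrow> ratfun) \<Rightarrow> nat \<Rightarrow> nat \<Rightarrow> ratfun" where
  "spec_hook x a b = specialize x (hook a b)"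

lemma spec_complete_0 [simp]: "spec_complete x 0 = 1"
  and spec_elem_0 [simp]: "spec_elem x 0 = 1"
  by (simp_all add: spec_complete_def spec_elem_def)

lemma spec_hook_0: "spec_hook x a 0 = spec_complete x a"
  by (simp add: spec_hook_def spec_complete_def hook_0)

lemma spec_hook_Suc:
  "spec_hook x a (Suc b) = spec_complete x a * spec_elem x (Suc b) - spec_hook x (Suc a) b"
  by (simp add: spec_hook_def spec_complete_def spec_elem_def hook_Suc specialize_mult
      specialize_diff)

lemma specialize_minus_one_power: "specialize x ((-1) ^ n) = (-1) ^ n"
  by (simp add: specialize_power specialize_minus)

lemma fps_deriv_spec_complete:
  "fps_deriv (Abs_fps (spec_complete x)) = Abs_fps (\<lambda>k. x (Suc k)) * Abs_fps (spec_complete x)"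
proof (rule fps_ext)
  fix n
  have "specialize x (fps_nth (fps_deriv complete_fps) n)
      = specialize x (fps_nth (Abs_fps (\<lambda>k. powersum (Suc k)) * complete_fps) n)"
    by (simp add: fps_deriv_complete_fps)
  then show "fps_nth (fps_deriv (Abs_fps (spec_complete x))) n
      = fps_nth (Abs_fps (\<lambda>k. x (Suc k)) * Abs_fps (spec_complete x)) n"
    by (simp add: complete_fps_def spec_complete_def fps_mult_nth specialize_sum specialize_mult
        specialize_of_nat specialize_powersum del: of_nat_Suc of_nat_diff)
qed

lemma spec_complete_mult_spec_elem:
  "Abs_fps (spec_complete x) * Abs_fps (\<lambda>n. (-1) ^ n * spec_elem x n) = 1"
proof (rule fps_ext)
  fix n
  have "specialize x (fps_nth (complete_fps * signed_elem_fps) n) = specialize x (fps_nth 1 n)"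
    by (simp add: complete_mult_signed_elem)
  then show "fps_nth (Abs_fps (spec_complete x) * Abs_fps (\<lambda>n. (-1) ^ n * spec_elem x n)) n
      = fps_nth 1 n"
    by (cases "n = 0") (simp_all add: complete_fps_def signed_elem_fps_def spec_complete_def spec_elem_def
        fps_mult_nth specialize_sum specialize_mult specialize_minus_one_power
        del: of_nat_Suc of_nat_diff)
qed

lemma fps_mult_one_minus_monom_nth:
  fixes f :: "'a::comm_ring_1 fps"
  shows "fps_nth (f * (1 - fps_const c * fps_X ^ k)) n
    = fps_nth f n - (if n < k then 0 else c * fps_nth f (n - k))"
proof -
  have "f * (1 - fps_const c * fps_X ^ k) = f - fps_const c * (f * fps_X ^ k)"
    by (simp add: right_diff_distrib mult.left_commute)
  then show ?thesis by (simp add: fps_X_power_mult_right_nth)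
qed

lemmas fps_mult_one_minus_X_nth = fps_mult_one_minus_monom_nth[of _ _ 1, unfolded power_one_right]

text \<open>With U = 1 - c z and V = 1 - d z the hypothesis becomes H(s z) U(z) = H(t z) V(z), and
  comparing coefficients gives two-term recurrences. Both \<open>delta_spec 1\<close> and
  \<open>pstar N\<close> have this shape.\<close>

lemma
  assumes "\<And>n. (s ^ Suc n - t ^ Suc n) * x (Suc n) = c ^ Suc n - d ^ Suc n"
  shows spec_complete_geometric:
      "(s ^ Suc n - t ^ Suc n) * spec_complete x (Suc n)
        = (c * s ^ n - d * t ^ n) * spec_complete x n" (is ?h)
    and spec_elem_geometric:
      "(s ^ Suc n - t ^ Suc n) * spec_elem x (Suc n) = (c * t ^ n - d * s ^ n) * spec_elem x n"
      (is ?e)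
proof -
  let ?H = "Abs_fps (spec_complete x)" and ?F = "Abs_fps (\<lambda>n. (-1) ^ n * spec_elem x n)"
  have geo: "fps_deriv (1 - fps_const c * fps_X)
      = - (Abs_fps (\<lambda>n. c ^ Suc n) * (1 - fps_const c * fps_X))" for c :: ratfun
    unfolding fps_eq_iff fps_deriv_nth fps_neg_nth fps_mult_one_minus_X_nth
    by (auto simp: fps_X_def not_less_eq_eq power_eq_if)
  have H: "fps_dilate s ?H * (1 - fps_const c * fps_X) = fps_dilate t ?H * (1 - fps_const d * fps_X)"
    by (rule fps_q_difference[OF fps_deriv_spec_complete geo geo]) (use assms in simp_all)
  have F: "fps_dilate t ?F * (1 - fps_const c * fps_X) = fps_dilate s ?F * (1 - fps_const d * fps_X)"
    by (rule fps_q_difference_inverse[OF H spec_complete_mult_spec_elem])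
  have nth: "fps_nth (fps_dilate s f * (1 - fps_const c * fps_X)) (Suc n)
      = s ^ Suc n * fps_nth f (Suc n) - c * s ^ n * fps_nth f n" for s c and f :: "ratfun fps"
    unfolding fps_mult_one_minus_X_nth by (simp add: mult_ac)
  show ?h using arg_cong[OF H, of "\<lambda>f. fps_nth f (Suc n)"] unfolding nth
    by (simp add: algebra_simps)
  have "(-1) ^ n * ((s ^ Suc n - t ^ Suc n) * spec_elem x (Suc n))
      = (-1) ^ n * ((c * t ^ n - d * s ^ n) * spec_elem x n)"
    using arg_cong[OF F, of "\<lambda>f. fps_nth f (Suc n)"] unfolding nth
    by (simp add: algebra_simps)
  then show ?e by simp
qed

text \<open>The shape of \<open>delta_spec 2\<close>: only even power sums survive, so U = 1 - c z^2
  and V = 1. The recurrences then preserve parity, and the coefficient of z starts the odd chain at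
  zero when s and t differ.\<close>

lemma
  assumes "\<And>n. (s ^ Suc n - t ^ Suc n) * x (Suc n) = (if odd n then 2 * c ^ (Suc n div 2) else 0)"
  shows spec_complete_even:
      "(s ^ (n + 2) - t ^ (n + 2)) * spec_complete x (n + 2) = c * s ^ n * spec_complete x n"
      (is ?h)
    and spec_elem_even:
      "(s ^ (n + 2) - t ^ (n + 2)) * spec_elem x (n + 2) = - c * t ^ n * spec_elem x n" (is ?e)
    and spec_complete_even_1: "(s - t) * spec_complete x 1 = 0" (is ?h1)
proof -
  let ?H = "Abs_fps (spec_complete x)" and ?F = "Abs_fps (\<lambda>n. (-1) ^ n * spec_elem x n)"
  have geo: "fps_deriv (1 - fps_const c * fps_X ^ 2)
      = - (Abs_fps (\<lambda>n. if odd n then 2 * c ^ (Suc n div 2) else 0) * (1 - fps_const c * fps_X ^ 2))"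
  proof (rule fps_ext)
    fix n :: nat
    \<comment> \<open>Degrees 0 and 1 lie below the shift by z^2 and are checked separately.\<close>
    have "n = 0 \<or> n = 1 \<or> (\<exists>k. n = k + 2)" by presburger
    then show "fps_nth (fps_deriv (1 - fps_const c * fps_X ^ 2)) n = fps_nth
        (- (Abs_fps (\<lambda>n. if odd n then 2 * c ^ (Suc n div 2) else 0) * (1 - fps_const c * fps_X ^ 2))) n"
      unfolding fps_deriv_nth fps_neg_nth fps_mult_one_minus_monom_nth
      by (elim disjE exE) (simp_all add: fps_X_power_iff del: of_nat_Suc)
  qed
  have one: "fps_deriv (1 :: ratfun fps) = - (0 * 1)" by simp
  have H: "fps_dilate s ?H * (1 - fps_const c * fps_X ^ 2) = fps_dilate t ?H * 1"
    by (rule fps_q_difference[OF fps_deriv_spec_complete geo one]) (use assms in simp_all)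
  have F: "fps_dilate t ?F * (1 - fps_const c * fps_X ^ 2) = fps_dilate s ?F * 1"
    by (rule fps_q_difference_inverse[OF H spec_complete_mult_spec_elem])
  have nth: "fps_nth (fps_dilate s f * (1 - fps_const c * fps_X ^ 2)) (n + 2)
      = s ^ (n + 2) * fps_nth f (n + 2) - c * s ^ n * fps_nth f n"
    and nth1: "fps_nth (fps_dilate s f * (1 - fps_const c * fps_X ^ 2)) 1 = s * fps_nth f 1"
    for s n and f :: "ratfun fps"
    unfolding fps_mult_one_minus_monom_nth by (simp_all add: mult_ac)
  show ?h using arg_cong[OF H, of "\<lambda>f. fps_nth f (n + 2)"] unfolding nth
    by (simp add: algebra_simps)
  show ?h1 using arg_cong[OF H, of "\<lambda>f. fps_nth f 1"] unfolding nth1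
    by (simp add: algebra_simps)
  have "(-1) ^ n * ((s ^ (n + 2) - t ^ (n + 2)) * spec_elem x (n + 2))
      = (-1) ^ n * (- c * t ^ n * spec_elem x n)"
    using arg_cong[OF F, of "\<lambda>f. fps_nth f (n + 2)"] unfolding nth
    by (simp add: algebra_simps)
  then show ?e unfolding mult_cancel_left by simp
qed

section \<open>The q-numbers and the three specializations\<close>

lemma qv_neq_0 [simp]: "qv \<noteq> 0"
  by (simp add: qv_def Zero_fract_def eq_fract)

lemma qv_power: "qv ^ n = Fract ([:0, 1:] ^ n) 1"
  by (induction n) (simp_all add: qv_def One_fract_def)

lemma qv_power_neq_1:
  assumes "n \<noteq> 0"
  shows "qv ^ n \<noteq> 1"
proof
  assume "qv ^ n = 1"
  then have "[:0, 1 :: rat:] ^ n = 1"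
    by (simp add: qv_power One_fract_def eq_fract)
  then have "degree ([:0, 1 :: rat:] ^ n) = 0" by simp
  then show False using assms by (simp add: degree_power_eq)
qed

lemma qv_powi_neq_1:
  assumes "n \<noteq> 0"
  shows "qv powi n \<noteq> 1"
  using qv_power_neq_1[of "nat \<bar>n\<bar>"] assms
  by (cases "n \<ge> 0") (auto simp: power_int_def field_simps)

text \<open>The common denominator of all q-numbers. Identities for \<open>qnum\<close> are proved
  by multiplying through with \<open>qu\<close>, which leaves Laurent monomials in q.\<close>

definition qu :: ratfun where
  "qu = inverse qv - qv"

lemma qv_powi_diff_neq_0:
  assumes "n \<noteq> 0"
  shows "qv powi (- n) - qv powi n \<noteq> 0"
proof
  assume "qv powi (- n) - qv powi n = 0"
  then have "qv powi n * qv powi n = 1"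
    by (simp add: power_int_minus field_simps)
  then have "qv powi (n + n) = 1"
    by (subst power_int_add) simp_all
  then show False
    using qv_powi_neq_1[of "n + n"] assms by simp
qed

lemma qu_neq_0 [simp]: "qu \<noteq> 0"
  using qv_powi_diff_neq_0[of 1] by (simp add: qu_def power_int_minus)

lemma qnum_neq_0: "n \<noteq> 0 \<Longrightarrow> qnum n \<noteq> 0"
  using qv_powi_diff_neq_0[of n] by (simp add: qnum_def flip: qu_def)

lemma qu_mult_qnum: "qu * qnum n = qv powi (- n) - qv powi n"
  by (simp add: qnum_def flip: qu_def)

lemma qu_mult_qnum_nat: "qu * qnum (int n) = inverse qv ^ n - qv ^ n"
  by (simp add: qu_mult_qnum power_int_minus power_inverse)

lemma qnum_0 [simp]: "qnum 0 = 0"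
  by (simp add: qnum_def)

lemma qnum_add: "qnum (x + y) = qv powi y * qnum x + qv powi (- x) * qnum y"
proof -
  have "qu * qnum (x + y) = qu * (qv powi y * qnum x + qv powi (- x) * qnum y)"
    unfolding distrib_left mult.left_commute[of qu] qu_mult_qnum
    by (simp add: power_int_add power_int_diff power_int_minus field_simps)
  then show ?thesis by simp
qed

text \<open>Clearing both denominators leaves an identity between Laurent monomials in q^a, q^b and
  q^x. It is the three-term relation that closes the induction for hooks under
  \<open>pstar\<close>.\<close>

lemma qnum_Pluecker: "qnum (a + b) * qnum x = qnum a * qnum (x - b) + qnum b * qnum (x + a)"
proof -
  define A B X where "A = qv powi a" and "B = qv powi b" and "X = qv powi x"
  have nz: "A \<noteq> 0" "B \<noteq> 0" "X \<noteq> 0" by (simp_all add: A_def B_def X_def)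
  have "(qu * qnum (a + b)) * (qu * qnum x)
      = (qu * qnum a) * (qu * qnum (x - b)) + (qu * qnum b) * (qu * qnum (x + a))"
    unfolding qu_mult_qnum
    using nz by (simp add: power_int_add power_int_minus power_int_diff flip: A_def B_def X_def)
      (simp add: field_simps)
  then have "(qu * qu) * (qnum (a + b) * qnum x)
      = (qu * qu) * (qnum a * qnum (x - b) + qnum b * qnum (x + a))"
    by (simp add: algebra_simps)
  then show ?thesis by simp
qed

text \<open>The summand \<open>0 ^ Suc n\<close> is kept so that this is literally the hypothesis of
  \<open>spec_complete_geometric\<close> with c = \<open>qu\<close> and d = 0.\<close>

lemma delta_spec_1_Suc:
  "(inverse qv ^ Suc n - qv ^ Suc n) * delta_spec 1 (Suc n) = qu ^ Suc n - 0 ^ Suc n"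
  using qv_powi_diff_neq_0[of "int (Suc n)"]
  by (simp add: delta_spec_def power_int_minus power_inverse flip: qu_def
      del: of_nat_Suc power_Suc)

lemma delta_spec_2_Suc:
  "(inverse qv ^ Suc n - qv ^ Suc n) * delta_spec 2 (Suc n)
    = (if odd n then 2 * qu ^ (Suc n div 2) else 0)"
  using qv_powi_diff_neq_0[of "int (Suc n)"]
  by (simp add: delta_spec_def power_int_minus power_inverse flip: qu_def
      del: of_nat_Suc power_Suc)

lemma pstar_Suc:
  "(inverse qv ^ Suc n - qv ^ Suc n) * pstar N (Suc n) = (inverse qv ^ N) ^ Suc n - (qv ^ N) ^ Suc n"
  using qv_powi_diff_neq_0[of "int (Suc n)"]
  unfolding pstar_def of_nat_mult[symmetric] power_int_minus power_int_of_nat power_mult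
    power_inverse by simp

abbreviation "h1 \<equiv> spec_complete (delta_spec 1)"
abbreviation "e1 \<equiv> spec_elem (delta_spec 1)"
abbreviation "h2 \<equiv> spec_complete (delta_spec 2)"
abbreviation "e2 \<equiv> spec_elem (delta_spec 2)"

lemma h1_Suc: "qnum (int (Suc n)) * h1 (Suc n) = inverse qv ^ n * h1 n"
  and e1_Suc: "qnum (int (Suc n)) * e1 (Suc n) = qv ^ n * e1 n"
proof -
  have "qu * (qnum (int (Suc n)) * h1 (Suc n)) = qu * (inverse qv ^ n * h1 n)"
    using spec_complete_geometric[OF delta_spec_1_Suc, of n]
    unfolding qu_mult_qnum_nat[symmetric] by (simp add: mult_ac del: of_nat_Suc)
  then show "qnum (int (Suc n)) * h1 (Suc n) = inverse qv ^ n * h1 n" by simp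
  have "qu * (qnum (int (Suc n)) * e1 (Suc n)) = qu * (qv ^ n * e1 n)"
    using spec_elem_geometric[OF delta_spec_1_Suc, of n]
    unfolding qu_mult_qnum_nat[symmetric] by (simp add: mult_ac del: of_nat_Suc)
  then show "qnum (int (Suc n)) * e1 (Suc n) = qv ^ n * e1 n" by simp
qed

lemma h2_add_2: "qnum (int (n + 2)) * h2 (n + 2) = inverse qv ^ n * h2 n"
  and e2_add_2: "qnum (int (n + 2)) * e2 (n + 2) = - (qv ^ n * e2 n)"
proof -
  have "qu * (qnum (int (n + 2)) * h2 (n + 2)) = qu * (inverse qv ^ n * h2 n)"
    using spec_complete_even[OF delta_spec_2_Suc, of n]
    unfolding qu_mult_qnum_nat[symmetric] by (simp only: mult_ac)
  then show "qnum (int (n + 2)) * h2 (n + 2) = inverse qv ^ n * h2 n" by simp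
  have "qu * (qnum (int (n + 2)) * e2 (n + 2)) = qu * (- (qv ^ n * e2 n))"
    using spec_elem_even[OF delta_spec_2_Suc, of n]
    unfolding qu_mult_qnum_nat[symmetric] by (simp only: mult_ac mult_minus_left mult_minus_right)
  then show "qnum (int (n + 2)) * e2 (n + 2) = - (qv ^ n * e2 n)"
    unfolding mult_cancel_left by simp
qed

text \<open>The recurrence preserves parity and the odd chain starts from h_1 = 0.\<close>

lemma h2_odd: "h2 (2 * n + 1) = 0"
proof (induction n)
  case 0
  have "inverse qv - qv \<noteq> 0" using qu_neq_0 by (simp add: qu_def)
  then show ?case
    using spec_complete_even_1[OF delta_spec_2_Suc] by simp
next
  case (Suc n)
  have "2 * Suc n + 1 = (2 * n + 1) + 2" by simp
  moreover have "qnum (int ((2 * n + 1) + 2)) \<noteq> 0" by (rule qnum_neq_0) simp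
  ultimately show ?case
    using h2_add_2[of "2 * n + 1"] Suc by (metis mult_zero_right mult_eq_0_iff)
qed

lemma hstar_Suc:
    "qnum (int (Suc n)) * spec_complete (pstar N) (Suc n)
      = qnum (int N + int n) * spec_complete (pstar N) n"
  and estar_Suc:
    "qnum (int (Suc n)) * spec_elem (pstar N) (Suc n)
      = qnum (int N - int n) * spec_elem (pstar N) n"
proof -
  have "qu * qnum (int N + int n) = inverse qv ^ N * inverse qv ^ n - qv ^ N * qv ^ n"
    by (simp add: qu_mult_qnum_nat power_add flip: of_nat_add)
  then have "qu * (qnum (int (Suc n)) * spec_complete (pstar N) (Suc n))
      = qu * (qnum (int N + int n) * spec_complete (pstar N) n)"
    using spec_complete_geometric[OF pstar_Suc, of n N]
    unfolding qu_mult_qnum_nat[symmetric] by (simp only: mult.assoc[symmetric])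
  then show "qnum (int (Suc n)) * spec_complete (pstar N) (Suc n)
      = qnum (int N + int n) * spec_complete (pstar N) n" by simp
  have "qu * qnum (int N - int n) = inverse qv ^ N * qv ^ n - qv ^ N * inverse qv ^ n"
    by (simp add: qu_mult_qnum power_int_diff power_int_minus field_simps)
  then have "qu * (qnum (int (Suc n)) * spec_elem (pstar N) (Suc n))
      = qu * (qnum (int N - int n) * spec_elem (pstar N) n)"
    using spec_elem_geometric[OF pstar_Suc, of n N]
    unfolding qu_mult_qnum_nat[symmetric] by (simp only: mult.assoc[symmetric])
  then show "qnum (int (Suc n)) * spec_elem (pstar N) (Suc n)
      = qnum (int N - int n) * spec_elem (pstar N) n" by simp
qed

subsection \<open>Hooks\<close>

text \<open>Induction along \<open>spec_hook_Suc\<close>: the recurrences for \<open>h1\<close> and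
  \<open>e1\<close> turn the subtracted hook into a multiple of h_a e_{b+1}, which cancels one
  summand of the q-addition formula for [a + b + 1].\<close>

lemma spec_hook_delta_1:
  "qnum (int (a + b)) * spec_hook (delta_spec 1) a b = qnum (int a) * qv ^ b * h1 a * e1 b"
proof (induction b arbitrary: a)
  case 0
  then show ?case by (simp add: spec_hook_0)
next
  case (Suc b)
  have 1: "qnum (int (a + Suc b)) * spec_hook (delta_spec 1) a (Suc b)
      = qnum (int (a + Suc b)) * h1 a * e1 (Suc b)
        - qnum (int (Suc a + b)) * spec_hook (delta_spec 1) (Suc a) b"
    by (simp add: spec_hook_Suc algebra_simps)
  have "qnum (int (Suc a + b)) * spec_hook (delta_spec 1) (Suc a) b
      = (qnum (int (Suc a)) * h1 (Suc a)) * (qv ^ b * e1 b)"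
    by (simp only: Suc.IH mult_ac)
  also have "\<dots> = inverse qv ^ a * h1 a * (qnum (int (Suc b)) * e1 (Suc b))"
    by (simp only: h1_Suc e1_Suc)
  finally have 2: "qnum (int (Suc a + b)) * spec_hook (delta_spec 1) (Suc a) b
      = inverse qv ^ a * h1 a * (qnum (int (Suc b)) * e1 (Suc b))" .
  have 3: "qnum (int (a + Suc b)) = qv ^ Suc b * qnum (int a) + inverse qv ^ a * qnum (int (Suc b))"
    unfolding of_nat_add qnum_add by (simp add: power_int_minus power_inverse del: of_nat_Suc power_Suc)
  have "qnum (int (a + Suc b)) * h1 a * e1 (Suc b)
      - inverse qv ^ a * h1 a * (qnum (int (Suc b)) * e1 (Suc b))
      = qnum (int a) * qv ^ Suc b * h1 a * e1 (Suc b)"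
    unfolding 3 by (simp add: algebra_simps)
  then show ?case unfolding 1 2 .
qed

text \<open>Odd complete functions vanish here, so the product term of \<open>spec_hook_Suc\<close>
  disappears. This ties leg length 2b + 1 to leg length 2b.\<close>

lemma spec_hook_delta_2_odd:
  "spec_hook (delta_spec 2) (2 * k + 1) (2 * b + 1) = - spec_hook (delta_spec 2) (2 * k + 2) (2 * b)"
  using spec_hook_Suc[of "delta_spec 2" "2 * k + 1" "2 * b"] h2_odd[of k] by simp

text \<open>The leg shrinks by two in each step, passing through the odd hook. Its sign flip makes
  the smaller hook enter with a plus, the minus in \<open>e2_add_2\<close> compensates, and the
  cancellation is then the one used for \<open>delta_spec 1\<close>.\<close>

lemma spec_hook_delta_2_even:
  "qnum (int (2 * a + 2 * b)) * spec_hook (delta_spec 2) (2 * a) (2 * b)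
    = qnum (int (2 * a)) * qv ^ (2 * b) * h2 (2 * a) * e2 (2 * b)"
proof (induction b arbitrary: a)
  case 0
  then show ?case by (simp add: spec_hook_0)
next
  case (Suc b)
  have "spec_hook (delta_spec 2) (2 * a) (2 * Suc b)
      = h2 (2 * a) * e2 (2 * Suc b) + spec_hook (delta_spec 2) (2 * Suc a) (2 * b)"
    using spec_hook_Suc[of "delta_spec 2" "2 * a" "2 * b + 1"]
      spec_hook_delta_2_odd[of a b] by simp
  then have 1: "qnum (int (2 * a + 2 * Suc b)) * spec_hook (delta_spec 2) (2 * a) (2 * Suc b)
      = qnum (int (2 * a + 2 * Suc b)) * h2 (2 * a) * e2 (2 * Suc b)
        + qnum (int (2 * Suc a + 2 * b)) * spec_hook (delta_spec 2) (2 * Suc a) (2 * b)"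
    by (simp add: algebra_simps)
  have "qnum (int (2 * Suc a + 2 * b)) * spec_hook (delta_spec 2) (2 * Suc a) (2 * b)
      = (qnum (int (2 * a + 2)) * h2 (2 * a + 2)) * (qv ^ (2 * b) * e2 (2 * b))"
    unfolding Suc.IH by (simp add: mult_ac)
  also have "\<dots> = inverse qv ^ (2 * a) * h2 (2 * a) * - (qnum (int (2 * b + 2)) * e2 (2 * b + 2))"
    by (simp only: h2_add_2 e2_add_2 minus_minus)
  finally have 2: "qnum (int (2 * Suc a + 2 * b)) * spec_hook (delta_spec 2) (2 * Suc a) (2 * b)
      = inverse qv ^ (2 * a) * h2 (2 * a) * - (qnum (int (2 * Suc b)) * e2 (2 * Suc b))" by simp
  have 3: "qnum (int (2 * a + 2 * Suc b))
      = qv ^ (2 * Suc b) * qnum (int (2 * a)) + inverse qv ^ (2 * a) * qnum (int (2 * Suc b))"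
    unfolding of_nat_add[of "2 * a" "2 * Suc b"] qnum_add power_int_minus power_int_of_nat
      power_inverse ..
  have "qnum (int (2 * a + 2 * Suc b)) * h2 (2 * a) * e2 (2 * Suc b)
      + inverse qv ^ (2 * a) * h2 (2 * a) * - (qnum (int (2 * Suc b)) * e2 (2 * Suc b))
      = qnum (int (2 * a)) * qv ^ (2 * Suc b) * h2 (2 * a) * e2 (2 * Suc b)"
    unfolding 3 by (simp add: algebra_simps)
  then show ?case unfolding 1 2 .
qed

section \<open>q-factorials and the hook-content formula\<close>

definition qfact :: "nat \<Rightarrow> ratfun" where
  "qfact n = (\<Prod>i<n. qnum (int (Suc i)))"

definition qdfact_even :: "nat \<Rightarrow> ratfun" where
  "qdfact_even n = (\<Prod>i<n. qnum (2 * int (Suc i)))"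

definition qrising :: "int \<Rightarrow> nat \<Rightarrow> ratfun" where
  "qrising x n = (\<Prod>i<n. qnum (x + int i))"

lemma qfact_0 [simp]: "qfact 0 = 1" and qfact_Suc: "qfact (Suc n) = qfact n * qnum (int (Suc n))"
  by (simp_all add: qfact_def)

lemma qdfact_even_0 [simp]: "qdfact_even 0 = 1"
  and qdfact_even_Suc: "qdfact_even (Suc n) = qdfact_even n * qnum (2 * int (Suc n))"
  by (simp_all add: qdfact_even_def)

lemma qfact_neq_0 [simp]: "qfact n \<noteq> 0"
  by (auto simp: qfact_def intro!: qnum_neq_0)

lemma qdfact_even_neq_0 [simp]: "qdfact_even n \<noteq> 0"
  by (auto simp: qdfact_even_def intro!: qnum_neq_0)

lemma qrising_0 [simp]: "qrising x 0 = 1"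
  and qrising_Suc: "qrising x (Suc n) = qrising x n * qnum (x + int n)"
  by (simp_all add: qrising_def)

lemma qrising_Suc': "qrising x (Suc n) = qnum x * qrising (x + 1) n"
  unfolding qrising_def by (subst prod.lessThan_Suc_shift) (simp add: add.assoc)

lemma qrising_add: "qrising x (m + n) = qrising x m * qrising (x + int m) n"
  by (induction n) (simp_all add: qrising_Suc add.assoc)

lemma qfact_mult_hstar: "qfact n * spec_complete (pstar N) n = qrising (int N) n"
proof (induction n)
  case (Suc n)
  have "qfact (Suc n) * spec_complete (pstar N) (Suc n)
      = qfact n * (qnum (int (Suc n)) * spec_complete (pstar N) (Suc n))"
    by (simp only: qfact_Suc mult_ac)
  also have "\<dots> = (qfact n * spec_complete (pstar N) n) * qnum (int N + int n)"
    by (simp only: hstar_Suc mult_ac)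
  finally show ?case by (simp only: Suc qrising_Suc)
qed simp

lemma qfact_mult_estar: "qfact n * spec_elem (pstar N) n = qrising (int N - int n + 1) n"
proof (induction n)
  case (Suc n)
  have "qfact (Suc n) * spec_elem (pstar N) (Suc n)
      = qfact n * (qnum (int (Suc n)) * spec_elem (pstar N) (Suc n))"
    by (simp only: qfact_Suc mult_ac)
  also have "\<dots> = qnum (int N - int n) * (qfact n * spec_elem (pstar N) n)"
    by (simp only: estar_Suc mult_ac)
  finally show ?case by (simp add: Suc qrising_Suc')
qed simp

text \<open>The hook-content formula for one hook: the hook lengths are a + b + 1 at the corner, 1,
  ..., a along the arm and 1, ..., b down the leg, and the contents run from -b to a.\<close>

lemma spec_hook_pstar:
  "qnum (int (Suc a + b)) * qfact a * qfact b * spec_hook (pstar N) (Suc a) b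
    = qrising (int N - int b) (Suc a + b)"
proof (induction b arbitrary: a)
  case 0
  then show ?case
    using qfact_mult_hstar[of "Suc a" N] by (simp add: spec_hook_0 qfact_Suc mult_ac)
next
  case (Suc b)
  define n where "n = Suc a + Suc b"
  define Q where "Q = qrising (int N - int b) (Suc a + b)"
  have "qnum (int (Suc a))
        * (qnum (int n) * qfact a * qfact (Suc b) * spec_hook (pstar N) (Suc a) (Suc b))
      = qnum (int n) * (qfact (Suc a) * spec_complete (pstar N) (Suc a))
          * (qfact (Suc b) * spec_elem (pstar N) (Suc b))
        - qnum (int (Suc b)) * (qnum (int (Suc (Suc a) + b)) * qfact (Suc a) * qfact b
            * spec_hook (pstar N) (Suc (Suc a)) b)"
    by (simp add: n_def spec_hook_Suc qfact_Suc algebra_simps)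
  also have "\<dots> = qnum (int n) * qrising (int N) (Suc a) * qrising (int N - int b) (Suc b)
      - qnum (int (Suc b)) * qrising (int N - int b) (Suc (Suc a + b))"
    unfolding Suc.IH qfact_mult_hstar qfact_mult_estar by simp
  \<comment> \<open>The two rising products cover N, ..., N + a and N - b, ..., N. They overlap only
    in [N], so together they are Q [N].\<close>
  also have "qnum (int n) * qrising (int N) (Suc a) * qrising (int N - int b) (Suc b)
      = Q * (qnum (int n) * qnum (int N))"
    unfolding Q_def add.commute[of "Suc a" b] qrising_add by (simp add: qrising_Suc)
  also have "qrising (int N - int b) (Suc (Suc a + b)) = Q * qnum (int N + int (Suc a))"
    unfolding Q_def qrising_Suc by simp
  \<comment> \<open>\<open>qnum_Pluecker\<close> is applied at x = N; its second summand is exactly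
    what is subtracted.\<close>
  also have "Q * (qnum (int n) * qnum (int N)) - qnum (int (Suc b)) * (Q * qnum (int N + int (Suc a)))
      = qnum (int (Suc a)) * (qnum (int N - int (Suc b)) * Q)"
    unfolding n_def of_nat_add[of "Suc a" "Suc b"] qnum_Pluecker by (simp add: algebra_simps)
  also have "qnum (int N - int (Suc b)) * Q = qrising (int N - int (Suc b)) n"
  proof -
    have "n = Suc (Suc a + b)" by (simp add: n_def)
    then show ?thesis by (simp only: Q_def qrising_Suc') simp
  qed
  finally show ?case
    using qnum_neq_0[of "int (Suc a)"] by (simp add: n_def)
qed

subsection \<open>The correlator as a sum over hooks\<close>

text \<open>The recurrence gives h_n = q^{-n(n-1)/2} / [n]!. At n = 2a the exponent is -a(2a - 1),
  with no halving.\<close>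

lemma h1_even: "qfact (2 * a) * h1 (2 * a) = qv powi (- (int a * (2 * int a - 1)))"
proof (induction a)
  case (Suc a)
  have "qfact (2 * Suc a) * h1 (2 * Suc a)
      = qfact (2 * a) * qnum (int (Suc (2 * a))) * (qnum (int (Suc (Suc (2 * a)))) * h1 (Suc (Suc (2 * a))))"
    by (simp add: qfact_Suc mult_ac)
  also have "\<dots> = qfact (2 * a) * (qnum (int (Suc (2 * a))) * h1 (Suc (2 * a))) * inverse qv ^ Suc (2 * a)"
    unfolding h1_Suc[of "Suc (2 * a)"] by (simp only: mult_ac)
  also have "\<dots> = (qfact (2 * a) * h1 (2 * a)) * inverse qv ^ (4 * a + 1)"
    unfolding h1_Suc[of "2 * a"] by (simp add: mult_ac power_add[symmetric])
  also have "\<dots> = qv powi (- (int a * (2 * int a - 1)) + - int (4 * a + 1))"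
    unfolding power_int_add[OF disjI1[OF qv_neq_0]] Suc power_int_minus[of _ "int (4 * a + 1)"]
      power_int_of_nat power_inverse ..
  also have "- (int a * (2 * int a - 1)) + - int (4 * a + 1) = - (int (Suc a) * (2 * int (Suc a) - 1))"
    by (simp add: algebra_simps)
  finally show ?case .
qed simp

lemma e1_even: "qfact (2 * a) * e1 (2 * a) = qv powi (int a * (2 * int a - 1))"
proof (induction a)
  case (Suc a)
  have "qfact (2 * Suc a) * e1 (2 * Suc a)
      = qfact (2 * a) * qnum (int (Suc (2 * a))) * (qnum (int (Suc (Suc (2 * a)))) * e1 (Suc (Suc (2 * a))))"
    by (simp add: qfact_Suc mult_ac)
  also have "\<dots> = qfact (2 * a) * (qnum (int (Suc (2 * a))) * e1 (Suc (2 * a))) * qv ^ Suc (2 * a)"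
    unfolding e1_Suc[of "Suc (2 * a)"] by (simp only: mult_ac)
  also have "\<dots> = (qfact (2 * a) * e1 (2 * a)) * qv ^ (4 * a + 1)"
    unfolding e1_Suc[of "2 * a"] by (simp add: mult_ac power_add[symmetric])
  also have "\<dots> = qv powi (int a * (2 * int a - 1) + int (4 * a + 1))"
    unfolding power_int_add[OF disjI1[OF qv_neq_0], of "int a * (2 * int a - 1)"] Suc
      power_int_of_nat ..
  also have "int a * (2 * int a - 1) + int (4 * a + 1) = int (Suc a) * (2 * int (Suc a) - 1)"
    by (simp add: algebra_simps)
  finally show ?case .
qed simp

lemma h2_even: "qdfact_even a * h2 (2 * a) = qv powi (- (int a * (int a - 1)))"
proof (induction a)
  case (Suc a)
  have "qdfact_even (Suc a) * h2 (2 * Suc a)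
      = qdfact_even a * (qnum (int (2 * a + 2)) * h2 (2 * a + 2))"
    by (simp add: qdfact_even_Suc mult_ac)
  also have "\<dots> = (qdfact_even a * h2 (2 * a)) * inverse qv ^ (2 * a)"
    unfolding h2_add_2 by (simp only: mult_ac)
  also have "\<dots> = qv powi (- (int a * (int a - 1)) + - int (2 * a))"
    unfolding Suc by (subst power_int_add) (simp_all add: power_int_minus power_inverse del: of_nat_mult)
  also have "- (int a * (int a - 1)) + - int (2 * a) = - (int (Suc a) * (int (Suc a) - 1))"
    by (simp add: algebra_simps)
  finally show ?case .
qed simp

lemma e2_even: "qdfact_even a * e2 (2 * a) = (-1) ^ a * qv powi (int a * (int a - 1))"
proof (induction a)
  case (Suc a)
  have "qdfact_even (Suc a) * e2 (2 * Suc a)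
      = qdfact_even a * (qnum (int (2 * a + 2)) * e2 (2 * a + 2))"
    by (simp add: qdfact_even_Suc mult_ac)
  also have "\<dots> = - (qdfact_even a * e2 (2 * a)) * qv ^ (2 * a)"
    unfolding e2_add_2 by (simp add: mult_ac)
  also have "\<dots> = (-1) ^ Suc a * qv powi (int a * (int a - 1) + int (2 * a))"
    unfolding Suc by (subst power_int_add) (simp_all del: of_nat_mult)
  also have "int a * (int a - 1) + int (2 * a) = int (Suc a) * (int (Suc a) - 1)"
    by (simp add: algebra_simps)
  finally show ?case .
qed simp

section \<open>Weights of single hooks and of hook pairs\<close>

definition hook_weight :: "nat \<Rightarrow> nat \<Rightarrow> nat \<Rightarrow> ratfun" where
  "hook_weight N a b =
    spec_hook (delta_spec 2) a b / spec_hook (delta_spec 1) a b * spec_hook (pstar N) a b"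

text \<open>The factors [2a + 2b], [2a] and q^{2b} are common to the hook formulas of both
  specializations. What remains is a quotient of products h_{2a} e_{2b}, whose closed forms are
  known.\<close>

lemma hook_ratio_even:
  assumes "a + b \<noteq> 0" "a \<noteq> 0"
  shows "spec_hook (delta_spec 2) (2 * a) (2 * b) / spec_hook (delta_spec 1) (2 * a) (2 * b)
    = (-1) ^ b * qv powi (int a * int a - int b * int b)
      * (qfact (2 * a) * qfact (2 * b)) / (qdfact_even a * qdfact_even b)"
proof -
  have nz: "qnum (int (2 * a + 2 * b)) \<noteq> 0" "qnum (int (2 * a)) \<noteq> 0"
    using assms by (auto intro!: qnum_neq_0)
  have "spec_hook (delta_spec 2) (2 * a) (2 * b) / spec_hook (delta_spec 1) (2 * a) (2 * b)
      = (qnum (int (2 * a + 2 * b)) * spec_hook (delta_spec 2) (2 * a) (2 * b))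
        / (qnum (int (2 * a + 2 * b)) * spec_hook (delta_spec 1) (2 * a) (2 * b))"
    using nz by simp
  also have "\<dots> = (h2 (2 * a) * e2 (2 * b)) / (h1 (2 * a) * e1 (2 * b))"
  proof -
    have "(c * p * x * y) / (c * p * u * v) = (x * y) / (u * v)" if "c \<noteq> 0" "p \<noteq> 0"
      for c p x y u v :: ratfun
      using that by (simp add: field_simps)
    then show ?thesis
      unfolding spec_hook_delta_2_even spec_hook_delta_1[of "2 * a" "2 * b"]
      using nz(2) by simp
  qed
  also have "\<dots> = ((qdfact_even a * h2 (2 * a)) * (qdfact_even b * e2 (2 * b)))
      / ((qfact (2 * a) * h1 (2 * a)) * (qfact (2 * b) * e1 (2 * b)))
      * (qfact (2 * a) * qfact (2 * b)) / (qdfact_even a * qdfact_even b)"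
  proof -
    have "(x * y) / (u * v) = ((A * x) * (B * y)) / ((C * u) * (D * v)) * (C * D) / (A * B)"
      if "A \<noteq> 0" "B \<noteq> 0" "C \<noteq> 0" "D \<noteq> 0" for A B C D x y u v :: ratfun
      using that by (simp add: mult_ac)
    then show ?thesis by (metis qfact_neq_0 qdfact_even_neq_0)
  qed
  also have "((qdfact_even a * h2 (2 * a)) * (qdfact_even b * e2 (2 * b)))
      / ((qfact (2 * a) * h1 (2 * a)) * (qfact (2 * b) * e1 (2 * b)))
    = (-1) ^ b * qv powi (- (int a * (int a - 1)) + int b * (int b - 1)
        - (- (int a * (2 * int a - 1)) + int b * (2 * int b - 1)))"
    unfolding h1_even e1_even h2_even e2_even
    by (subst power_int_diff, simp, subst power_int_add, simp, subst power_int_add, simp) simp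
  also have "- (int a * (int a - 1)) + int b * (int b - 1)
        - (- (int a * (2 * int a - 1)) + int b * (2 * int b - 1)) = int a * int a - int b * int b"
    by (simp add: algebra_simps)
  finally show ?thesis .
qed

text \<open>Reduces the hook with leg 2b + 1 to its partner with leg 2b, so that only even hooks
  need a closed form. Both are given by \<open>spec_hook_delta_1\<close>, and one step of the
  recurrences for \<open>h1\<close> and \<open>e1\<close> links them.\<close>

lemma spec_hook_delta_1_odd:
  "qnum (int (2 * b + 1)) * spec_hook (delta_spec 1) (2 * k + 1) (2 * b + 1)
    = qnum (int (2 * k + 1)) * qv ^ (2 * (Suc k + b)) * spec_hook (delta_spec 1) (2 * k + 2) (2 * b)"
proof -
  define n where "n = qnum (int (2 * k + 2 + 2 * b))"
  have n0: "n \<noteq> 0" unfolding n_def by (rule qnum_neq_0) simp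
  have h: "qv ^ (2 * k + 1) * (qnum (int (2 * k + 2)) * h1 (2 * k + 2)) = h1 (2 * k + 1)"
    using h1_Suc[of "2 * k + 1"] by (simp add: field_simps)
  have "n * (qnum (int (2 * b + 1)) * spec_hook (delta_spec 1) (2 * k + 1) (2 * b + 1))
      = qnum (int (2 * b + 1)) * (qnum (int (2 * k + 1 + (2 * b + 1)))
          * spec_hook (delta_spec 1) (2 * k + 1) (2 * b + 1))"
    by (simp add: n_def algebra_simps)
  also have "\<dots> = qnum (int (2 * k + 1)) * qv ^ (2 * b + 1) * h1 (2 * k + 1)
      * (qnum (int (Suc (2 * b))) * e1 (Suc (2 * b)))"
    unfolding spec_hook_delta_1 by simp
  also have "\<dots> = qnum (int (2 * k + 1)) * qv ^ (2 * (Suc k + b))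
      * (qnum (int (2 * k + 2)) * qv ^ (2 * b) * h1 (2 * k + 2) * e1 (2 * b))"
    unfolding e1_Suc h[symmetric] by (simp add: power_add power_mult_distrib mult_ac)
  also have "\<dots> = n * (qnum (int (2 * k + 1)) * qv ^ (2 * (Suc k + b))
      * spec_hook (delta_spec 1) (2 * k + 2) (2 * b))"
    unfolding spec_hook_delta_1[symmetric] n_def by (simp only: mult_ac)
  finally show ?thesis using n0 by simp
qed

text \<open>Both hooks have size 2m and enter the power sum with opposite signs. A second minus from
  \<open>spec_hook_delta_2_odd\<close> makes the two terms add, \<open>spec_hook_delta_1_odd\<close>
  contributes q^{-2m}, and [2k + 1] and [2b + 1] are absorbed by the q-factorials of the
  hook-content formula.\<close>

lemma hook_weight_pair:
  fixes k b N :: nat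
  defines "m \<equiv> Suc k + b"
  shows "hook_weight N (2 * k + 2) (2 * b) - hook_weight N (2 * k + 1) (2 * b + 1)
    = (-1) ^ b * qv powi (int (Suc k) * int (Suc k) - int b * int b)
        / (qnum (2 * int m) * qdfact_even k * qdfact_even b)
      * (qrising (int N - 2 * int b) (2 * m)
          + qv powi (- 2 * int m) * qrising (int N - 2 * int b - 1) (2 * m))"
proof -
  define R where "R = spec_hook (delta_spec 2) (2 * k + 2) (2 * b)
    / spec_hook (delta_spec 1) (2 * k + 2) (2 * b)"
  define P0 P1 where "P0 = qrising (int N - 2 * int b) (2 * m)"
    and "P1 = qrising (int N - 2 * int b - 1) (2 * m)"
  define n where "n = qnum (2 * int m)"
  have n0: "n \<noteq> 0" unfolding n_def m_def by (rule qnum_neq_0) simp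
  have nz: "qnum (int (2 * k + 1)) \<noteq> 0" "qnum (int (2 * b + 1)) \<noteq> 0"  "qnum (int (2 * k + 2)) \<noteq> 0"
    by (auto intro!: qnum_neq_0)
  have "spec_hook (delta_spec 1) (2 * k + 1) (2 * b + 1)
      = qnum (int (2 * k + 1)) * qv ^ (2 * m) * spec_hook (delta_spec 1) (2 * k + 2) (2 * b)
        / qnum (int (2 * b + 1))"
    using spec_hook_delta_1_odd[of b k] nz by (simp add: field_simps m_def)
  moreover have "qv powi (- 2 * int m) = inverse (qv ^ (2 * m))"
    by (simp add: power_int_minus flip: power_int_of_nat)
  ultimately have ratio: "spec_hook (delta_spec 2) (2 * k + 1) (2 * b + 1)
        / spec_hook (delta_spec 1) (2 * k + 1) (2 * b + 1)
      = - (R * (qnum (int (2 * b + 1)) / qnum (int (2 * k + 1)) * qv powi (- 2 * int m)))"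
    unfolding spec_hook_delta_2_odd R_def by (simp add: divide_inverse mult_ac)
  have R: "R = (-1) ^ b * qv powi (int (Suc k) * int (Suc k) - int b * int b)
      * (qfact (2 * Suc k) * qfact (2 * b)) / (qdfact_even (Suc k) * qdfact_even b)"
    using hook_ratio_even[of "Suc k" b] by (simp add: R_def)
  have s0: "spec_hook (pstar N) (2 * k + 2) (2 * b) = P0 / (n * qfact (2 * k + 1) * qfact (2 * b))"
    using spec_hook_pstar[of "2 * k + 1" "2 * b" N] n0
    by (simp add: P0_def n_def m_def field_simps)
  have s1: "spec_hook (pstar N) (2 * k + 1) (2 * b + 1) = P1 / (n * qfact (2 * k) * qfact (2 * b + 1))"
    using spec_hook_pstar[of "2 * k" "2 * b + 1" N] n0
    by (simp add: P1_def n_def m_def field_simps)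
  have f1: "qfact (2 * k + 1) = qfact (2 * k) * qnum (int (2 * k + 1))"
    "qfact (2 * b + 1) = qfact (2 * b) * qnum (int (2 * b + 1))"
    "qfact (2 * Suc k) = qfact (2 * k) * qnum (int (2 * k + 1)) * qnum (int (2 * k + 2))"
    "qdfact_even (Suc k) = qdfact_even k * qnum (int (2 * k + 2))"
    by (simp_all add: qfact_Suc qdfact_even_Suc)
  define c d where "c = qnum (int (2 * k + 1))" and "d = qnum (int (2 * b + 1))"
  have cd: "c \<noteq> 0" "d \<noteq> 0" using nz by (auto simp: c_def d_def)
  have "hook_weight N (2 * k + 2) (2 * b) - hook_weight N (2 * k + 1) (2 * b + 1)
    = R * (P0 / (n * qfact (2 * k + 1) * qfact (2 * b)))
      + R * (d / c * qv powi (- 2 * int m))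
        * (P1 / (n * qfact (2 * k) * qfact (2 * b + 1)))"
    unfolding hook_weight_def ratio s0 s1 by (simp add: R_def c_def d_def)
  also have "\<dots> = R / (qfact (2 * k + 1) * qfact (2 * b)) / n * (P0 + qv powi (- 2 * int m) * P1)"
  proof -
    have "r * (p / (n * (f * c) * g)) + r * (d / c * z) * (p' / (n * f * (g * d)))
        = r / (f * c * g) / n * (p + z * p')" for r p p' f g z
      using cd(2) by (simp add: divide_inverse distrib_left mult_ac)
    then show ?thesis unfolding f1 c_def[symmetric] d_def[symmetric] .
  qed
  also have "R / (qfact (2 * k + 1) * qfact (2 * b))
      = (-1) ^ b * qv powi (int (Suc k) * int (Suc k) - int b * int b) / (qdfact_even k * qdfact_even b)"
    unfolding R f1 using nz by (simp add: field_simps del: of_nat_Suc)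
  finally show ?thesis unfolding P0_def P1_def n_def by (simp add: mult_ac)
qed

lemma sum_lessThan_double:
  fixes f :: "nat \<Rightarrow> 'a::comm_monoid_add"
  shows "(\<Sum>i<2 * m. f i) = (\<Sum>b<m. f (2 * b) + f (2 * b + 1))"
  by (induction m) (simp_all add: add_ac)

lemma q_gaussian_powersum:
  assumes "is_q_gaussian_average N E"
  shows "E (powersum (Suc n)) = (\<Sum>b\<le>n. (-1) ^ b * hook_weight N (Suc n - b) b)"
proof -
  interpret Vector_Spaces.linear sscale "(*)" E
    using assms by (simp add: is_q_gaussian_average_def)
  \<comment> \<open>Linearity refers to \<open>sscale\<close>, so the signs must first be written as
    scalars.\<close>
  have "(-1) ^ b * f = sscale ((-1) ^ b) f" for b f
  proof -
    have "sconst ((-1) ^ b) = (-1) ^ b"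
      by (induction b) (simp_all add: sconst_def single_uminus flip: single_one)
    then show ?thesis by (simp add: sscale_def)
  qed
  then have "E (powersum (Suc n)) = (\<Sum>b\<le>n. (-1) ^ b * E (hook (Suc n - b) b))"
    by (simp add: powersum_conv_hooks sum scale)
  also have "\<dots> = (\<Sum>b\<le>n. (-1) ^ b * hook_weight N (Suc n - b) b)"
  proof (rule sum.cong[OF refl])
    fix b assume "b \<in> {..n}"
    then have "is_partition ((Suc n - b) # replicate b 1)"
      by (intro is_partition_hook) auto
    then show "(-1) ^ b * E (hook (Suc n - b) b) = (-1) ^ b * hook_weight N (Suc n - b) b"
      using assms unfolding is_q_gaussian_average_def hook_weight_def spec_hook_def hook_def
      by simp
  qed
  finally show ?thesis .
qed

lemma q_gaussian_powersum_even:
  assumes "is_q_gaussian_average N E" "m \<ge> 1"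
  shows "E (powersum (2 * m)) = (\<Sum>b<m.
      (-1) ^ b * qv powi (int m * int m - 2 * int m * int b)
        / (qnum (2 * int m) * qdfact_even (m - 1 - b) * qdfact_even b)
      * (qrising (int N - 2 * int b) (2 * m)
          + qv powi (- 2 * int m) * qrising (int N - 2 * int b - 1) (2 * m)))"
    (is "_ = (\<Sum>b<m. ?t b)")
proof -
  have "Suc (2 * m - 1) = 2 * m" using assms by simp
  then have "E (powersum (2 * m)) = (\<Sum>b\<le>2 * m - 1. (-1) ^ b * hook_weight N (2 * m - b) b)"
    using q_gaussian_powersum[OF assms(1), of "2 * m - 1"] by (simp only:)
  also have "{..2 * m - 1} = {..<2 * m}" using assms by auto
  also have "(\<Sum>b<2 * m. (-1) ^ b * hook_weight N (2 * m - b) b)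
      = (\<Sum>b<m. hook_weight N (2 * m - 2 * b) (2 * b) - hook_weight N (2 * m - (2 * b + 1)) (2 * b + 1))"
    by (simp add: sum_lessThan_double)
  also have "\<dots> = (\<Sum>b<m. ?t b)"
  proof (rule sum.cong[OF refl])
    fix b assume "b \<in> {..<m}"
    then obtain k where k: "m = Suc k + b"
      by (metis add.commute add_Suc_right lessThan_iff less_imp_Suc_add)
    \<comment> \<open>Here Suc k = m - b, so the difference of squares is linear in b.\<close>
    have e: "int (Suc k) * int (Suc k) - int b * int b = int m * int m - 2 * int m * int b"
      by (simp add: k algebra_simps)
    have "2 * m - 2 * b = 2 * k + 2" "2 * m - (2 * b + 1) = 2 * k + 1" "m - 1 - b = k"
      by (simp_all add: k)
    then show "hook_weight N (2 * m - 2 * b) (2 * b) - hook_weight N (2 * m - (2 * b + 1)) (2 * b + 1) = ?t b"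
      using hook_weight_pair[of N k b, folded k] by (simp only: e)
  qed
  finally show ?thesis .
qed

section \<open>The q-binomial theorem\<close>

text \<open>The q-Pochhammer symbol (p; p)_n.\<close>

definition qpoch :: "'a::comm_ring_1 \<Rightarrow> nat \<Rightarrow> 'a" where
  "qpoch p n = (\<Prod>i<n. 1 - p ^ Suc i)"

lemma qpoch_0 [simp]: "qpoch p 0 = 1" and qpoch_Suc: "qpoch p (Suc n) = qpoch p n * (1 - p ^ Suc n)"
  by (simp_all add: qpoch_def)

text \<open>For \<open>k > n\<close> the truncated exponent \<open>n - k\<close> is harmless, because \<open>qbinom p n k = 0\<close> there.\<close>

fun qbinom :: "'a::comm_ring_1 \<Rightarrow> nat \<Rightarrow> nat \<Rightarrow> 'a" where
  "qbinom p n 0 = 1"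
| "qbinom p 0 (Suc k) = 0"
| "qbinom p (Suc n) (Suc k) = qbinom p n (Suc k) + p ^ (n - k) * qbinom p n k"

lemma qbinom_eq_0: "n < k \<Longrightarrow> qbinom p n k = 0"
  by (induction p n k rule: qbinom.induct) auto

lemma Suc_choose_2: "Suc n choose 2 = (n choose 2) + n"
  by (simp add: numeral_2_eq_2)

lemma zero_choose_2 [simp]: "0 choose 2 = 0"
  by (simp add: numeral_2_eq_2)

text \<open>In the Pascal recurrence the two summands acquire the weights 1 - p^{d+1} and p^{d+1} (1
  - p^{l+1}), which add up to 1 - p^{n+1}. The multiplied-out form avoids division and holds in any
  commutative ring.\<close>

lemma qpoch_mult_qbinom: "k \<le> n \<Longrightarrow> qpoch p k * qpoch p (n - k) * qbinom p n k = qpoch p n"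
proof (induction n arbitrary: k)
  case (Suc n)
  show ?case
  proof (cases k)
    case (Suc l)
    show ?thesis
    proof (cases "l = n")
      case True
      then show ?thesis
        using Suc Suc.IH[of n]
        by (simp add: qbinom_eq_0 qpoch_Suc) (metis mult.assoc mult.commute)
    next
      case False
      with Suc Suc.prems obtain d where d: "n = Suc l + d"
        using less_imp_Suc_add[of l n] by auto
      have 1: "qpoch p (Suc l) * qpoch p d * qbinom p n (Suc l) = qpoch p n"
        and 2: "qpoch p l * qpoch p (Suc d) * qbinom p n l = qpoch p n"
        using Suc.IH[of "Suc l"] Suc.IH[of l] d by (simp_all add: Suc_diff_le)
      have "qpoch p k * qpoch p (Suc n - k) * qbinom p (Suc n) k
          = (1 - p ^ Suc d) * (qpoch p (Suc l) * qpoch p d * qbinom p n (Suc l))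
            + p ^ Suc d * (1 - p ^ Suc l) * (qpoch p l * qpoch p (Suc d) * qbinom p n l)"
        using d Suc by (simp add: qpoch_Suc algebra_simps)
      also have "\<dots> = qpoch p (Suc n)"
        unfolding 1 2 by (simp add: qpoch_Suc d power_add algebra_simps)
      finally show ?thesis .
    qed
  qed simp
qed simp

text \<open>Multiplying by 1 - p^n y shifts the degree in y by one. Since C(j+1, 2) + (n - j) = C(j,
  2) + n, the shifted term is the second summand of the Pascal recurrence.\<close>

lemma q_binomial_theorem:
  fixes p y :: "'a::comm_ring_1"
  shows "(\<Prod>i<n. 1 - p ^ i * y) = (\<Sum>j\<le>n. (-1) ^ j * p ^ (j choose 2) * qbinom p n j * y ^ j)"
proof (induction n)
  case (Suc n)
  define f where "f j = (-1) ^ j * p ^ (j choose 2) * qbinom p n j * y ^ j" for j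
  have step: "(-1) ^ Suc j * p ^ (Suc j choose 2) * qbinom p (Suc n) (Suc j) * y ^ Suc j
      = f (Suc j) - p ^ n * y * f j" if "j \<le> n" for j
  proof -
    have "p ^ (Suc j choose 2) * p ^ (n - j) = p ^ n * p ^ (j choose 2)"
      using that by (simp add: Suc_choose_2 add.commute flip: power_add)
    then have "(-1) ^ Suc j * p ^ (Suc j choose 2) * (p ^ (n - j) * qbinom p n j) * y ^ Suc j
        = - (p ^ n * y * f j)"
      by (simp add: f_def mult_ac)
    then show ?thesis
      by (simp only: f_def qbinom.simps distrib_left distrib_right diff_conv_add_uminus)
  qed
  have "(\<Sum>j\<le>Suc n. (-1) ^ j * p ^ (j choose 2) * qbinom p (Suc n) j * y ^ j)
      = 1 + (\<Sum>j\<le>n. f (Suc j) - p ^ n * y * f j)"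
    unfolding sum.atMost_Suc_shift
    by (intro arg_cong2[of _ _ _ _ "(+)"] sum.cong refl) (simp_all only: step atMost_iff, simp)
  also have "\<dots> = (f 0 + (\<Sum>j\<le>n. f (Suc j))) - p ^ n * y * (\<Sum>j\<le>n. f j)"
    by (simp add: sum_subtractf sum_distrib_left f_def)
  also have "f 0 + (\<Sum>j\<le>n. f (Suc j)) = (\<Sum>j\<le>n. f j)"
    by (subst sum.atMost_Suc_shift[symmetric]) (simp add: f_def qbinom_eq_0)
  finally show ?case using Suc by (simp add: f_def algebra_simps)
qed simp

lemma qpoch_inverse:
  fixes p :: "'a::field"
  assumes "p \<noteq> 0"
  shows "qpoch p n = (-1) ^ n * p ^ (Suc n choose 2) * qpoch (inverse p) n"
proof (induction n)
  case (Suc n)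
  have "1 - p ^ Suc n = - (p ^ Suc n * (1 - inverse p ^ Suc n))"
    using assms by (simp add: field_simps)
  then show ?case
    unfolding qpoch_Suc Suc Suc_choose_2[of "Suc n"] power_add by simp
qed (simp add: numeral_2_eq_2)

lemma qpoch_add: "qpoch p (m + n) = qpoch p m * (\<Prod>i<n. 1 - p ^ (m + Suc i))"
  by (induction n) (simp_all add: qpoch_Suc mult.assoc)

lemma qpoch_square: "qpoch (p ^ 2) n = qpoch p n * (\<Prod>i<n. 1 + p ^ Suc i)"
proof (induction n)
  case (Suc n)
  have "1 - (p ^ 2) ^ Suc n = (1 - p ^ Suc n) * (1 + p ^ Suc n)"
    by (simp add: algebra_simps power2_eq_square power_mult_distrib)
  then show ?case
    unfolding qpoch_Suc Suc prod.lessThan_Suc by (simp only: mult_ac)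
qed simp

section \<open>Expansion of the correlator\<close>

lemma qv_powi_add: "qv powi (x + y) = qv powi x * qv powi y"
  by (simp add: power_int_add)

lemma qv_powi_mult_nat: "qv powi (x * int n) = (qv powi x) ^ n"
  by (simp add: power_int_mult)

lemma qv_power_power_neq_1: "k \<noteq> 0 \<Longrightarrow> n \<noteq> 0 \<Longrightarrow> (qv ^ k) ^ n \<noteq> 1"
  using qv_power_neq_1[of "k * n"] by (simp add: power_mult)

lemma qpoch_qv_neq_0: "k \<noteq> 0 \<Longrightarrow> qpoch (qv ^ k) n \<noteq> 0"
  using qv_power_power_neq_1[of k "Suc _"] by (auto simp: qpoch_def)

lemma double_choose_two: "2 * int (n choose 2) = int n * (int n - 1)"
  by (induction n) (simp_all add: Suc_choose_2 algebra_simps)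

text \<open>Each factor \<open>qu * qnum (x + i)\<close> equals q^{-(x+i)} (1 - q^{2(x+i)}). This
  puts the rising product in the form of the q-binomial theorem in base q^2 with y = q^{2x}.\<close>

lemma qu_power_mult_qrising:
  "qu ^ n * qrising x n = qv powi (- (int n * x) - int (n choose 2))
    * (\<Prod>i<n. 1 - (qv ^ 2) ^ i * qv powi (2 * x))"
proof (induction n)
  case (Suc n)
  have e: "- (int (Suc n) * x) - int (Suc n choose 2)
      = (- (int n * x) - int (n choose 2)) + - (x + int n)"
    by (simp add: Suc_choose_2 algebra_simps)
  have "qv powi (x + int n) = qv powi (- (x + int n)) * qv powi (2 * x + int (2 * n))"
    unfolding qv_powi_add[symmetric] by (simp add: algebra_simps)
  also have "qv powi (2 * x + int (2 * n)) = (qv ^ 2) ^ n * qv powi (2 * x)"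
    unfolding qv_powi_add power_int_of_nat power_mult by (rule mult.commute)
  finally have q: "qu * qnum (x + int n)
      = qv powi (- (x + int n)) * (1 - (qv ^ 2) ^ n * qv powi (2 * x))"
    unfolding qu_mult_qnum by (simp add: algebra_simps)
  have "qu ^ Suc n * qrising x (Suc n) = (qu ^ n * qrising x n) * (qu * qnum (x + int n))"
    by (simp only: qrising_Suc power_Suc mult_ac)
  then show ?case
    unfolding Suc q e qv_powi_add[of "- (int n * x) - int (n choose 2)"] prod.lessThan_Suc
    by (simp only: mult_ac)
qed simp

lemma qu_power_mult_qdfact_even:
  "qu ^ n * qdfact_even n = qv powi (- (int n * (int n + 1))) * qpoch (qv ^ 4) n"
proof (induction n)
  case (Suc n)
  have e: "- (int (Suc n) * (int (Suc n) + 1)) = - (int n * (int n + 1)) + - (2 * int (Suc n))"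
    by (simp add: algebra_simps)
  have "qv powi (2 * int (Suc n)) = qv powi (- (2 * int (Suc n))) * qv powi (int (4 * Suc n))"
    unfolding qv_powi_add[symmetric] by (simp add: algebra_simps)
  also have "qv powi (int (4 * Suc n)) = (qv ^ 4) ^ Suc n"
    unfolding power_int_of_nat power_mult ..
  finally have q: "qu * qnum (2 * int (Suc n)) = qv powi (- (2 * int (Suc n))) * (1 - (qv ^ 4) ^ Suc n)"
    unfolding qu_mult_qnum by (simp add: algebra_simps)
  have "qu ^ Suc n * qdfact_even (Suc n) = (qu ^ n * qdfact_even n) * (qu * qnum (2 * int (Suc n)))"
    by (simp only: qdfact_even_Suc power_Suc[of qu] mult_ac)
  then show ?case
    unfolding Suc q e qv_powi_add[of "- (int n * (int n + 1))"] qpoch_Suc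
    by (simp only: mult_ac)
qed simp

text \<open>(q^4; q^4)_m supplies the even-indexed factors of (q^2; q^2)_{2m}, and the odd q-numbers
  supply the others. Through this identity [2m - 1]!! enters the result.\<close>

lemma qu_power_mult_qdfact_odd:
  "qu ^ m * qdfact_odd m * qpoch (qv ^ 4) m = qv powi (- (int m * int m)) * qpoch (qv ^ 2) (2 * m)"
proof (induction m)
  case 0
  then show ?case by (simp add: qdfact_odd_def)
next
  case (Suc m)
  have e: "- (int (Suc m) * int (Suc m)) = - (int m * int m) + - (2 * int (Suc m) - 1)"
    by (simp add: algebra_simps)
  have "qv powi (2 * int (Suc m) - 1)
      = qv powi (- (2 * int (Suc m) - 1)) * qv powi (int (2 * Suc (2 * m)))"
    unfolding qv_powi_add[symmetric] by (simp add: algebra_simps)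
  also have "qv powi (int (2 * Suc (2 * m))) = (qv ^ 2) ^ Suc (2 * m)"
    unfolding power_int_of_nat power_mult ..
  finally have 1: "qu * qnum (2 * int (Suc m) - 1)
      = qv powi (- (2 * int (Suc m) - 1)) * (1 - (qv ^ 2) ^ Suc (2 * m))"
    unfolding qu_mult_qnum by (simp add: algebra_simps)
  have 2: "(qv ^ 4) ^ Suc m = (qv ^ 2) ^ Suc (Suc (2 * m))"
    unfolding power_mult[symmetric] by (rule arg_cong[of _ _ "\<lambda>n. qv ^ n"]) simp
  have 3: "qdfact_odd (Suc m) = qdfact_odd m * qnum (2 * int (Suc m) - 1)"
    by (simp add: qdfact_odd_def)
  have "qu ^ Suc m * qdfact_odd (Suc m) * qpoch (qv ^ 4) (Suc m)
      = (qu ^ m * qdfact_odd m * qpoch (qv ^ 4) m) * (qu * qnum (2 * int (Suc m) - 1))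
        * (1 - (qv ^ 4) ^ Suc m)"
    unfolding 3 qpoch_Suc power_Suc[of qu] by (simp only: mult_ac)
  also have "\<dots> = qv powi (- (int (Suc m) * int (Suc m))) * qpoch (qv ^ 2) (Suc (Suc (2 * m)))"
    unfolding Suc 1 2 e qv_powi_add[of "- (int m * int m)"] qpoch_Suc by (simp only: mult_ac)
  finally show ?case by simp
qed

text \<open>Replacing x by x - 1 changes the j-th term of the expansion by q^{-2(j-m)}. Together
  with the prefactor q^{-2m} this is q^{-2j}, so the two expansions merge into one.\<close>

lemma qrising_pair_expand:
  "qu ^ (2 * m) * (qrising x (2 * m) + qv powi (- 2 * int m) * qrising (x - 1) (2 * m))
    = (\<Sum>j\<le>2 * m. (-1) ^ j * (qv ^ 2) ^ (j choose 2) * qbinom (qv ^ 2) (2 * m) j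
        * (1 + qv powi (- 2 * int j)) * qv powi (2 * x * (int j - int m) - int m * (2 * int m - 1)))"
proof -
  define \<kappa> where "\<kappa> j = (-1) ^ j * (qv ^ 2) ^ (j choose 2) * qbinom (qv ^ 2) (2 * m) j" for j
  have c2: "int (2 * m choose 2) = int m * (2 * int m - 1)"
    using double_choose_two[of "2 * m"] by simp
  have rise: "qu ^ (2 * m) * qrising x (2 * m)
      = (\<Sum>j\<le>2 * m. \<kappa> j * qv powi (2 * x * (int j - int m) - int m * (2 * int m - 1)))" for x
    unfolding qu_power_mult_qrising q_binomial_theorem sum_distrib_left
  proof (rule sum.cong[OF refl])
    fix j
    have pw: "qv powi (- (int (2 * m) * x) - int (2 * m choose 2)) * (qv powi (2 * x)) ^ j
        = qv powi (2 * x * (int j - int m) - int m * (2 * int m - 1))"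
      unfolding c2 qv_powi_mult_nat[symmetric] qv_powi_add[symmetric]
      by (rule arg_cong[of _ _ "\<lambda>n. qv powi n"]) (simp add: algebra_simps)
    show "qv powi (- (int (2 * m) * x) - int (2 * m choose 2))
        * ((-1) ^ j * (qv ^ 2) ^ (j choose 2) * qbinom (qv ^ 2) (2 * m) j * (qv powi (2 * x)) ^ j)
        = \<kappa> j * qv powi (2 * x * (int j - int m) - int m * (2 * int m - 1))"
      unfolding \<kappa>_def pw[symmetric] by (simp only: mult_ac)
  qed
  have e: "qv powi (- 2 * int m) * (\<kappa> j * qv powi (2 * (x - 1) * (int j - int m) - int m * (2 * int m - 1)))
      = \<kappa> j * (qv powi (- 2 * int j) * qv powi (2 * x * (int j - int m) - int m * (2 * int m - 1)))" for j
    unfolding mult.left_commute[of "qv powi (- 2 * int m)"] qv_powi_add[symmetric]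
    by (rule arg_cong[of _ _ "\<lambda>n. \<kappa> j * qv powi n"]) (simp add: algebra_simps)
  have "qu ^ (2 * m) * (qrising x (2 * m) + qv powi (- 2 * int m) * qrising (x - 1) (2 * m))
      = qu ^ (2 * m) * qrising x (2 * m)
        + qv powi (- 2 * int m) * (qu ^ (2 * m) * qrising (x - 1) (2 * m))"
    by (simp only: distrib_left mult_ac)
  also have "\<dots> = (\<Sum>j\<le>2 * m. \<kappa> j * (1 + qv powi (- 2 * int j))
      * qv powi (2 * x * (int j - int m) - int m * (2 * int m - 1)))"
    unfolding rise sum_distrib_left e sum.distrib[symmetric]
    by (simp only: distrib_left distrib_right mult_1_right mult.assoc)
  finally show ?thesis unfolding \<kappa>_def .
qed

text \<open>After multiplication by \<open>qu ^ (m - 1)\<close> the denominators become q-Pochhammer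
  symbols in base q^4, and the sum over b is the q-binomial theorem read from right to left.\<close>

lemma even_sum_eval:
  assumes "m \<ge> 1"
  shows "(\<Sum>b<m. (-1) ^ b * qv powi (- 2 * int m * int b - 4 * int b * (int j - int m))
        / (qdfact_even (m - 1 - b) * qdfact_even b))
    = qu ^ (m - 1) * qv powi (int m * (int m - 1)) / qpoch (qv ^ 4) (m - 1)
      * (\<Prod>i<m - 1. 1 - qv powi (4 * (int i + 1 - int j)))"
    (is "?L = ?C * ?P")
proof -
  define M where "M = m - 1"
  have m: "m = Suc M" using assms by (simp add: M_def)
  \<comment> \<open>Chosen so that (q^4)^i y = q^{4(i+1-j)}.\<close>
  define y where "y = qv powi (4 - 4 * int j)"
  have nz: "qpoch (qv ^ 4) n \<noteq> 0" for n by (rule qpoch_qv_neq_0) simp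
  have "?P = (\<Prod>i<M. 1 - (qv ^ 4) ^ i * y)"
  proof (unfold M_def[symmetric], rule prod.cong[OF refl])
    fix i
    have "(qv ^ 4) ^ i * y = qv powi (int (4 * i) + (4 - 4 * int j))"
      unfolding y_def qv_powi_add power_int_of_nat power_mult ..
    also have "int (4 * i) + (4 - 4 * int j) = 4 * (int i + 1 - int j)" by simp
    finally show "1 - qv powi (4 * (int i + 1 - int j)) = 1 - (qv ^ 4) ^ i * y" by simp
  qed
  also have "\<dots> = (\<Sum>b\<le>M. (-1) ^ b * (qv ^ 4) ^ (b choose 2) * qbinom (qv ^ 4) M b * y ^ b)"
    by (rule q_binomial_theorem)
  finally have P: "?C * ?P
      = (\<Sum>b\<le>M. ?C * ((-1) ^ b * (qv ^ 4) ^ (b choose 2) * qbinom (qv ^ 4) M b * y ^ b))"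
    by (simp only: sum_distrib_left)
  have "?L = (\<Sum>b\<le>M. (-1) ^ b * qv powi (- 2 * int m * int b - 4 * int b * (int j - int m))
        / (qdfact_even (M - b) * qdfact_even b))"
    unfolding m by (simp add: lessThan_Suc_atMost)
  also have "\<dots> = ?C * ?P"
    unfolding P
  proof (rule sum.cong[OF refl])
    fix b assume "b \<in> {..M}"
    then have b: "b \<le> M" by simp
    let ?F = "qpoch (qv ^ 4)"
    have M': "M = (M - b) + b" using b by simp
    have "qu ^ M * (qdfact_even (M - b) * qdfact_even b)
        = (qu ^ (M - b) * qdfact_even (M - b)) * (qu ^ b * qdfact_even b)"
      by (subst M', subst power_add) (simp only: mult_ac)
    also have "\<dots> = qv powi (- (int (M - b) * (int (M - b) + 1)) + - (int b * (int b + 1)))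
        * (?F (M - b) * ?F b)"
      unfolding qu_power_mult_qdfact_even qv_powi_add by (simp only: mult_ac)
    finally have den: "qu ^ M * (qdfact_even (M - b) * qdfact_even b)
      = qv powi (- (int (M - b) * (int (M - b) + 1)) + - (int b * (int b + 1))) * (?F (M - b) * ?F b)" .
    \<comment> \<open>The left exponent is linear in b: the squares of b coming from the two double
      factorials are offset by 4 C(b, 2).\<close>
    have "qv powi (- 2 * int m * int b - 4 * int b * (int j - int m))
        = qv powi (- (int (M - b) * (int (M - b) + 1)) + - (int b * (int b + 1))
            + int m * (int m - 1) + 4 * int (b choose 2) + (4 - 4 * int j) * int b)"
    proof (rule arg_cong[of _ _ "\<lambda>n. qv powi n"])
      have "4 * int (b choose 2) = 2 * (int b * (int b - 1))"
        using double_choose_two[of b] by simp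
      then show "- 2 * int m * int b - 4 * int b * (int j - int m)
          = - (int (M - b) * (int (M - b) + 1)) + - (int b * (int b + 1))
            + int m * (int m - 1) + 4 * int (b choose 2) + (4 - 4 * int j) * int b"
        using b by (simp add: m of_nat_diff algebra_simps)
    qed
    also have "\<dots> = qv powi (- (int (M - b) * (int (M - b) + 1)) + - (int b * (int b + 1)))
          * qv powi (int m * (int m - 1)) * (qv ^ 4) ^ (b choose 2) * y ^ b"
    proof -
      have "qv powi (4 * int (b choose 2)) = (qv ^ 4) ^ (b choose 2)"
        by (simp add: qv_powi_mult_nat)
      moreover have "qv powi ((4 - 4 * int j) * int b) = y ^ b"
        by (simp add: y_def qv_powi_mult_nat)
      ultimately show ?thesis by (simp only: qv_powi_add)
    qed
    finally have num: "qv powi (- 2 * int m * int b - 4 * int b * (int j - int m))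
        = qv powi (- (int (M - b) * (int (M - b) + 1)) + - (int b * (int b + 1)))
          * qv powi (int m * (int m - 1)) * (qv ^ 4) ^ (b choose 2) * y ^ b" .
    have bin: "qbinom (qv ^ 4) M b = ?F M / (?F (M - b) * ?F b)"
      using qpoch_mult_qbinom[OF b, of "qv ^ 4"] nz by (simp add: field_simps)
    have "(-1) ^ b * qv powi (- 2 * int m * int b - 4 * int b * (int j - int m))
        / (qdfact_even (M - b) * qdfact_even b)
      = qu ^ M * ((-1) ^ b * qv powi (- 2 * int m * int b - 4 * int b * (int j - int m)))
        / (qu ^ M * (qdfact_even (M - b) * qdfact_even b))"
      by simp
    also have "\<dots> = qu ^ M * ((-1) ^ b * (qv powi (int m * (int m - 1)) * (qv ^ 4) ^ (b choose 2) * y ^ b))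
        / (?F (M - b) * ?F b)"
      unfolding den num by (simp add: mult.assoc mult.left_commute)
    also have "\<dots> = ?C * ((-1) ^ b * (qv ^ 4) ^ (b choose 2) * qbinom (qv ^ 4) M b * y ^ b)"
      unfolding bin M_def[symmetric] using nz[of M] by (simp add: mult_ac)
    finally show "(-1) ^ b * qv powi (- 2 * int m * int b - 4 * int b * (int j - int m))
        / (qdfact_even (M - b) * qdfact_even b)
      = ?C * ((-1) ^ b * (qv ^ 4) ^ (b choose 2) * qbinom (qv ^ 4) M b * y ^ b)" .
  qed
  finally show ?thesis .
qed

section \<open>Coefficients of the expansion in powers of q^{2N}\<close>

text \<open>The coefficient of q^{2N(j-m)} in the correlator. Base q^{-2} in the first denominator
  absorbs the sign (-1)^j and the power q^{j(j-1)} of the q-binomial theorem, leaving only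
  q^{-2j}.\<close>

definition correlator_coeff :: "nat \<Rightarrow> nat \<Rightarrow> ratfun" where
  "correlator_coeff m j = qdfact_odd m * qv powi (int m * int m + 2 * int m - 2 * int j)
    * (1 + qv powi (- 2 * int j)) * (\<Prod>i<m - 1. 1 - qv powi (4 * (int i + 1 - int j)))
    / (qpoch (inverse (qv ^ 2)) j * qpoch (qv ^ 2) (2 * m - j))"

lemma qpoch_inverse_qv_neq_0: "qpoch (inverse (qv ^ 2)) n \<noteq> 0"
proof
  assume "qpoch (inverse (qv ^ 2)) n = 0"
  then have "qpoch (qv ^ 2) n = 0" by (subst qpoch_inverse) simp_all
  then show False by (simp add: qpoch_qv_neq_0)
qed

text \<open>\<open>qu_power_mult_qdfact_odd\<close> turns (q^2; q^2)_{2m} into [2m - 1]!! times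
  (q^4; q^4)_m. Passing on to (q^4; q^4)_{m-1} releases [2m], which cancels, and so do all powers of
  \<open>qu\<close>.\<close>

lemma correlator_coeff_eq:
  assumes "j \<le> 2 * m" "m \<ge> 1"
  shows "inverse (qu ^ (2 * m)) * inverse (qnum (2 * int m))
      * ((-1) ^ j * (qv ^ 2) ^ (j choose 2) * qbinom (qv ^ 2) (2 * m) j * (1 + qv powi (- 2 * int j)))
      * (qu ^ (m - 1) * inverse (qpoch (qv ^ 4) (m - 1))
        * (\<Prod>i<m - 1. 1 - qv powi (4 * (int i + 1 - int j))))
    = correlator_coeff m j"
proof -
  let ?P = "\<Prod>i<m - 1. 1 - qv powi (4 * (int i + 1 - int j))"
  define F F4 G where "F = qpoch (qv ^ 2)" and "F4 = qpoch (qv ^ 4)" and "G = qpoch (inverse (qv ^ 2))"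
  have nz: "F n \<noteq> 0" "F4 n \<noteq> 0" "G n \<noteq> 0" for n
    unfolding F_def F4_def G_def by (simp_all add: qpoch_qv_neq_0 qpoch_inverse_qv_neq_0)
  obtain M where M: "m = Suc M" using assms by (cases m) auto
  have m1: "m - 1 = M" by (simp add: M)
  have n0: "qnum (2 * int m) \<noteq> 0" using assms by (intro qnum_neq_0) auto
  have "F j * F (2 * m - j) * qbinom (qv ^ 2) (2 * m) j = F (2 * m)"
    unfolding F_def by (rule qpoch_mult_qbinom) fact
  then have bin: "qbinom (qv ^ 2) (2 * m) j = F (2 * m) / (F j * F (2 * m - j))"
    using nz by (simp add: field_simps)
  have Fj: "F j = (-1) ^ j * ((qv ^ 2) ^ (j choose 2) * (qv ^ 2) ^ j) * G j"
    unfolding F_def G_def by (subst qpoch_inverse) (simp_all add: Suc_choose_2 power_add)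
  have sgn: "(-1) ^ j * (qv ^ 2) ^ (j choose 2) * qbinom (qv ^ 2) (2 * m) j
      = F (2 * m) / ((qv ^ 2) ^ j * G j * F (2 * m - j))"
    unfolding bin Fj using nz by simp
  have "qu ^ Suc M * qdfact_even (Suc M) = (qu ^ M * qdfact_even M) * (qu * qnum (2 * int m))"
    by (simp add: qdfact_even_Suc M mult_ac)
  then have "qv powi (- (int m * (int m + 1))) * F4 m
      = qv powi (- (int M * (int M + 1))) * F4 M * (qu * qnum (2 * int m))"
    unfolding qu_power_mult_qdfact_even F4_def M .
  also have "- (int M * (int M + 1)) = - (int m * (int m + 1)) + 2 * int m"
    by (simp add: M algebra_simps)
  finally have F4m: "F4 m = qv powi (2 * int m) * F4 M * (qu * qnum (2 * int m))"
    unfolding qv_powi_add by simp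
  have "qu ^ m * qdfact_odd m * F4 m = qv powi (- (int m * int m)) * F (2 * m)"
    unfolding F4_def F_def by (rule qu_power_mult_qdfact_odd)
  then have F2m: "F (2 * m) = qv powi (int m * int m) * (qu ^ m * qdfact_odd m * F4 m)"
    by (simp add: power_int_minus field_simps)
  have "inverse (qu ^ (2 * m)) * inverse (qnum (2 * int m))
      * (F (2 * m) / ((qv ^ 2) ^ j * G j * F (2 * m - j)) * (1 + qv powi (- 2 * int j)))
      * (qu ^ M * inverse (F4 M) * ?P)
    = (inverse (qu ^ (2 * m)) * qu ^ m * qu * qu ^ M) * (qnum (2 * int m) * inverse (qnum (2 * int m)))
      * (F4 M * inverse (F4 M))
      * (qdfact_odd m * (qv powi (int m * int m) * qv powi (2 * int m) * inverse ((qv ^ 2) ^ j))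
      * (1 + qv powi (- 2 * int j)) * ?P / (G j * F (2 * m - j)))"
    unfolding F2m F4m by (simp only: divide_inverse inverse_mult_distrib mult_ac)
  also have "inverse (qu ^ (2 * m)) * qu ^ m * qu * qu ^ M = 1"
  proof -
    have "2 * m = m + 1 + M" by (simp add: M)
    then have "qu ^ (2 * m) = qu ^ m * qu * qu ^ M" by (simp only: power_add power_one_right)
    then have "inverse (qu ^ (2 * m)) * (qu ^ m * qu * qu ^ M) = 1"
      by (metis left_inverse power_not_zero qu_neq_0)
    then show ?thesis by (simp only: mult.assoc)
  qed
  also have "qnum (2 * int m) * inverse (qnum (2 * int m)) = 1" using n0 by simp
  also have "F4 M * inverse (F4 M) = 1" using nz by simp
  also have "qv powi (int m * int m) * qv powi (2 * int m) * inverse ((qv ^ 2) ^ j)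
      = qv powi (int m * int m + 2 * int m - 2 * int j)"
    by (simp add: power_int_diff qv_powi_add divide_inverse power_int_mult)
  finally show ?thesis
    unfolding m1 sgn correlator_coeff_def F_def[symmetric] F4_def[symmetric] G_def[symmetric]
    by (simp only: mult_1_left)
qed

lemma q_gaussian_powersum_even_expand:
  assumes "is_q_gaussian_average N E" "m \<ge> 1"
  shows "E (powersum (2 * m))
    = (\<Sum>j\<le>2 * m. correlator_coeff m j * qv powi (2 * int N * (int j - int m)))"
proof -
  define \<kappa> where "\<kappa> j = (-1) ^ j * (qv ^ 2) ^ (j choose 2) * qbinom (qv ^ 2) (2 * m) j
    * (1 + qv powi (- 2 * int j))" for j
  define S where "S j b = (-1) ^ b * qv powi (- 2 * int m * int b - 4 * int b * (int j - int m))
        / (qdfact_even (m - 1 - b) * qdfact_even b)" for j b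
  define C where "C = inverse (qu ^ (2 * m)) * inverse (qnum (2 * int m))"
  have "E (powersum (2 * m)) = (\<Sum>b<m. \<Sum>j\<le>2 * m.
      C * \<kappa> j * S j b * qv powi (2 * int N * (int j - int m) - int m * (int m - 1)))"
    unfolding q_gaussian_powersum_even[OF assms]
  proof (rule sum.cong[OF refl])
    fix b
    let ?D = "qdfact_even (m - 1 - b) * qdfact_even b"
    have e: "(-1) ^ b * qv powi (int m * int m - 2 * int m * int b)
        / (qnum (2 * int m) * qdfact_even (m - 1 - b) * qdfact_even b) * T
      = C * ((-1) ^ b * qv powi (int m * int m - 2 * int m * int b) / ?D) * (qu ^ (2 * m) * T)" for T
      by (simp add: C_def divide_inverse mult_ac)
    show "(-1) ^ b * qv powi (int m * int m - 2 * int m * int b)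
        / (qnum (2 * int m) * qdfact_even (m - 1 - b) * qdfact_even b)
      * (qrising (int N - 2 * int b) (2 * m)
          + qv powi (- 2 * int m) * qrising (int N - 2 * int b - 1) (2 * m))
      = (\<Sum>j\<le>2 * m. C * \<kappa> j * S j b * qv powi (2 * int N * (int j - int m) - int m * (int m - 1)))"
      unfolding e qrising_pair_expand sum_distrib_left
    proof (rule sum.cong[OF refl])
      fix j
      \<comment> \<open>Separation of variables: the mixed term -4b(j - m) stays with b, and N is
        left only in a factor free of b, so the sum over b can be carried out first.\<close>
      have "qv powi (int m * int m - 2 * int m * int b)
          * qv powi (2 * (int N - 2 * int b) * (int j - int m) - int m * (2 * int m - 1))
        = qv powi (- 2 * int m * int b - 4 * int b * (int j - int m))
          * qv powi (2 * int N * (int j - int m) - int m * (int m - 1))"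
        unfolding qv_powi_add[symmetric]
        by (rule arg_cong[of _ _ "\<lambda>n. qv powi n"]) (simp add: algebra_simps)
      then have "C * \<kappa> j * ((-1) ^ b / ?D) * (qv powi (int m * int m - 2 * int m * int b)
          * qv powi (2 * (int N - 2 * int b) * (int j - int m) - int m * (2 * int m - 1)))
        = C * \<kappa> j * ((-1) ^ b / ?D) * (qv powi (- 2 * int m * int b - 4 * int b * (int j - int m))
          * qv powi (2 * int N * (int j - int m) - int m * (int m - 1)))"
        by (simp only:)
      then show "C * ((-1) ^ b * qv powi (int m * int m - 2 * int m * int b) / ?D)
          * ((-1) ^ j * (qv ^ 2) ^ (j choose 2) * qbinom (qv ^ 2) (2 * m) j * (1 + qv powi (- 2 * int j))
            * qv powi (2 * (int N - 2 * int b) * (int j - int m) - int m * (2 * int m - 1)))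
        = C * \<kappa> j * S j b * qv powi (2 * int N * (int j - int m) - int m * (int m - 1))"
        unfolding S_def \<kappa>_def[symmetric] by (simp only: divide_inverse mult_ac)
    qed
  qed
  also have "\<dots> = (\<Sum>j\<le>2 * m. C * \<kappa> j * (\<Sum>b<m. S j b)
      * qv powi (2 * int N * (int j - int m) - int m * (int m - 1)))"
    by (subst sum.swap) (simp only: sum_distrib_left sum_distrib_right)
  also have "\<dots> = (\<Sum>j\<le>2 * m. correlator_coeff m j * qv powi (2 * int N * (int j - int m)))"
  proof (rule sum.cong[OF refl])
    fix j assume "j \<in> {..2 * m}"
    then have j: "j \<le> 2 * m" by simp
    let ?P = "\<Prod>i<m - 1. 1 - qv powi (4 * (int i + 1 - int j))"
    have e: "qv powi (int m * (int m - 1)) * qv powi (2 * int N * (int j - int m) - int m * (int m - 1))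
        = qv powi (2 * int N * (int j - int m))"
      unfolding qv_powi_add[symmetric] by simp
    have sumS: "(\<Sum>b<m. S j b)
        = qu ^ (m - 1) * qv powi (int m * (int m - 1)) / qpoch (qv ^ 4) (m - 1) * ?P"
      unfolding S_def by (rule even_sum_eval) fact
    have "C * \<kappa> j * (\<Sum>b<m. S j b) * qv powi (2 * int N * (int j - int m) - int m * (int m - 1))
        = C * \<kappa> j * (qu ^ (m - 1) * inverse (qpoch (qv ^ 4) (m - 1)) * ?P)
          * qv powi (2 * int N * (int j - int m))"
      unfolding sumS e[symmetric] by (simp only: divide_inverse mult_ac)
    then show "C * \<kappa> j * (\<Sum>b<m. S j b) * qv powi (2 * int N * (int j - int m) - int m * (int m - 1))
        = correlator_coeff m j * qv powi (2 * int N * (int j - int m))"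
      unfolding correlator_coeff_eq[OF j assms(2), folded \<kappa>_def C_def] .
  qed
  finally show ?thesis .
qed

section \<open>Identification with the coefficients A and B\<close>

text \<open>The factor with i = j - 1 is 1 - q^0, and it lies in the range i < m - 1 exactly because
  1 <= j < m.\<close>

lemma correlator_coeff_eq_0:
  assumes "1 \<le> j" "j < m"
  shows "correlator_coeff m j = 0"
proof -
  have "(\<Prod>i<m - 1. 1 - qv powi (4 * (int i + 1 - int j))) = 0"
    using assms by (intro prod_zero bexI[of _ "j - 1"]) (auto simp: of_nat_diff)
  then show ?thesis by (simp add: correlator_coeff_def)
qed

text \<open>At j = 0 the product is (q^4; q^4)_{m-1}, which splits by difference of squares. One
  half cancels the first m - 1 factors of (q^2; q^2)_{2m}; the other is the numerator of
  \<open>coeffB\<close> after q^{2n} is pulled out of each factor.\<close>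

lemma correlator_coeff_0:
  assumes "m \<ge> 1"
  shows "correlator_coeff m 0 = coeffB m"
proof -
  obtain M where M: "m = Suc M" using assms by (cases m) auto
  define p where "p = qv ^ 2"
  have nz: "qpoch p n \<noteq> 0" for n unfolding p_def by (simp add: qpoch_qv_neq_0)
  have "(\<Prod>i<M. 1 - qv powi (4 * (int i + 1))) = qpoch (p ^ 2) M"
    unfolding qpoch_def p_def
  proof (rule prod.cong[OF refl])
    fix i
    have "4 * (int i + 1) = int (4 * Suc i)" by simp
    then have "qv powi (4 * (int i + 1)) = qv powi (int (4 * Suc i))" by (simp only:)
    also have "\<dots> = ((qv ^ 2) ^ 2) ^ Suc i"
      unfolding power_int_of_nat power_mult[symmetric] by simp
    finally show "1 - qv powi (4 * (int i + 1)) = 1 - ((qv ^ 2) ^ 2) ^ Suc i" by simp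
  qed
  also have "\<dots> = qpoch p M * (\<Prod>i<M. 1 + p ^ Suc i)"
    by (rule qpoch_square)
  finally have L: "correlator_coeff m 0 = qdfact_odd m * qv powi (int m * int m + 2 * int m) * 2
      * (qpoch p M * (\<Prod>i<M. 1 + p ^ Suc i)) / qpoch p (2 * m)"
    unfolding correlator_coeff_def p_def[symmetric] by (simp add: M)
  have "(\<Prod>n = 1..m. qv ^ (2 * n) + qv ^ (2 * m)) = (\<Prod>n = 1..m. p ^ n * (1 + p ^ (m - n)))"
  proof (rule prod.cong[OF refl])
    fix n assume "n \<in> {1..m}"
    then have "p ^ n * p ^ (m - n) = p ^ m" by (simp flip: power_add)
    then show "qv ^ (2 * n) + qv ^ (2 * m) = p ^ n * (1 + p ^ (m - n))"
      by (simp add: p_def distrib_left power_mult)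
  qed
  also have "\<dots> = (\<Prod>n = 1..m. p ^ n) * (\<Prod>n = 1..m. 1 + p ^ (m - n))"
    by (rule prod.distrib)
  also have "(\<Prod>n = 1..m. 1 + p ^ (m - n)) = (\<Prod>i<m. 1 + p ^ i)"
    by (rule prod.reindex_bij_witness[of _ "\<lambda>i. m - i" "\<lambda>n. m - n"]) auto
  \<comment> \<open>The factor i = 0, that is n = m, is the 2 that arises from 1 + q^{-2j} at j =
    0.\<close>
  also have "\<dots> = 2 * (\<Prod>i<M. 1 + p ^ Suc i)"
    unfolding M by (subst prod.lessThan_Suc_shift) simp
  also have "(\<Prod>n = 1..m. p ^ n) = qv powi (int m * (int m + 1))"
  proof (induction m)
    case (Suc m)
    have "p ^ Suc m = qv powi (int (2 * Suc m))"
      unfolding p_def power_int_of_nat power_mult ..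
    then have "(\<Prod>n = 1..Suc m. p ^ n) = qv powi (int m * (int m + 1) + int (2 * Suc m))"
      unfolding qv_powi_add Suc[symmetric] by simp
    also have "int m * (int m + 1) + int (2 * Suc m) = int (Suc m) * (int (Suc m) + 1)"
      by (simp add: algebra_simps)
    finally show ?case .
  qed simp
  finally have num: "(\<Prod>n = 1..m. qv ^ (2 * n) + qv ^ (2 * m))
      = qv powi (int m * (int m + 1)) * (2 * (\<Prod>i<M. 1 + p ^ Suc i))" .
  \<comment> \<open>With this splitting the exponents of the second product run from m to 2m, as in
    \<open>coeffB\<close>.\<close>
  have "2 * m = M + Suc m" by (simp add: M)
  then have "qpoch p (2 * m) = qpoch p M * (\<Prod>i<Suc m. 1 - p ^ (M + Suc i))"
    by (simp only: qpoch_add)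
  also have "(\<Prod>i<Suc m. 1 - p ^ (M + Suc i)) = (\<Prod>n = 0..m. 1 - qv ^ (2 * n + 2 * m))"
    unfolding atLeast0AtMost lessThan_Suc_atMost
  proof (rule prod.cong[OF refl])
    fix i
    have "2 * (M + Suc i) = 2 * i + 2 * m" by (simp add: M)
    then show "1 - p ^ (M + Suc i) = 1 - qv ^ (2 * i + 2 * m)"
      unfolding p_def power_mult[symmetric] by (simp only:)
  qed
  finally have den: "qpoch p (2 * m) = qpoch p M * (\<Prod>n = 0..m. 1 - qv ^ (2 * n + 2 * m))" .
  have e: "qv powi (int m * int m + 2 * int m) = qv ^ m * qv powi (int m * (int m + 1))"
    unfolding power_int_of_nat[symmetric] qv_powi_add[symmetric]
    by (rule arg_cong[of _ _ "\<lambda>n. qv powi n"]) (simp add: algebra_simps)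
  have gen: "x * (a * b) * 2 * (Q * R) / (Q * D) = x * a * (b * (2 * R) / D)"
    if "Q \<noteq> 0" for x a b Q R D :: ratfun
    using that by (simp add: mult_ac)
  show ?thesis
    unfolding L coeffB_def num den e by (rule gen) (rule nz)
qed

text \<open>With r = q^{-2} the product has factors 1 - r^{2(a+i)} for 0 < i < m, each a difference
  of squares. The factor 1 + x, where x = r^{m+a}, completes the plus half at i = m; completing the
  minus half costs 1 - x, which becomes q^{2m} - q^{-2a} in \<open>coeffA\<close>.\<close>

lemma correlator_coeff_add:
  assumes "a \<le> m" "m \<ge> 1"
  shows "correlator_coeff m (m + a) = coeffA m a"
proof -
  obtain M where M: "m = Suc M" using assms by (cases m) auto
  define r where "r = inverse (qv ^ 2)"
  define F G where "F = qpoch (qv ^ 2)" and "G = qpoch r"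
  have r: "r ^ n = qv powi (- 2 * int n)" for n
    by (simp add: r_def power_int_minus power_int_mult power_inverse)
  have nz: "F n \<noteq> 0" "G n \<noteq> 0" for n
    unfolding F_def G_def r_def by (simp_all add: qpoch_qv_neq_0 qpoch_inverse_qv_neq_0)
  define x where "x = r ^ (m + a)"
  have "x \<noteq> 1"
    unfolding x_def r using qv_powi_neq_1[of "- 2 * int (m + a)"] assms by simp
  then have x: "1 - x \<noteq> 0" by simp
  define Pp where "Pp = (\<Prod>i<m. 1 + r ^ (a + Suc i))"
  define Pm where "Pm = (\<Prod>i<m. 1 - r ^ (a + Suc i))"
  have G: "G (m + a) = G a * Pm"
    unfolding G_def Pm_def add.commute[of m] by (rule qpoch_add)
  have Pm: "Pm \<noteq> 0" using G nz(2)[of "m + a"] by auto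
  define P where "P = (\<Prod>i<M. 1 - qv powi (4 * (int i + 1 - int (m + a))))"
  have "P = (\<Prod>i<M. 1 - r ^ (a + Suc i) * r ^ (a + Suc i))"
    unfolding P_def
  proof (rule prod.reindex_bij_witness[of _ "\<lambda>i. M - Suc i" "\<lambda>i. M - Suc i"])
    fix i assume "i \<in> {..<M}"
    then show "1 - r ^ (a + Suc (M - Suc i)) * r ^ (a + Suc (M - Suc i))
        = 1 - qv powi (4 * (int i + 1 - int (m + a)))"
      unfolding r qv_powi_add[symmetric] by (auto simp: M of_nat_diff algebra_simps)
  qed auto
  \<comment> \<open>Multiplying by 1 - x^2 adds the missing last factor, at index m - 1.\<close>
  then have "P * (1 - x * x) = (\<Prod>i<m. 1 - r ^ (a + Suc i) * r ^ (a + Suc i))"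
    by (simp add: M x_def add.commute[of a])
  also have "\<dots> = Pm * Pp"
    unfolding Pm_def Pp_def prod.distrib[symmetric] by (simp add: algebra_simps)
  finally have "P * (1 + x) * (1 - x) = Pm * Pp" by (simp add: algebra_simps)
  have key: "(1 + x) * P / (G (m + a) * F (m - a)) = Pp / ((1 - x) * (G a * F (m - a)))"
  proof -
    have "(1 + x) * P = Pm * Pp / (1 - x)"
      using x \<open>P * (1 + x) * (1 - x) = Pm * Pp\<close> by (simp add: eq_divide_eq mult_ac)
    then show ?thesis unfolding G using Pm by simp
  qed
  have e0: "int m * int m + 2 * int m - 2 * int (m + a) = int m * int m - 2 * int a"
    and e1: "m - 1 = M" and e2: "2 * m - (m + a) = m - a"
    by (simp_all add: M)
  have L: "correlator_coeff m (m + a)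
      = qdfact_odd m * qv powi (int m * int m - 2 * int a)
        * ((1 + x) * P / (G (m + a) * F (m - a)))"
    unfolding correlator_coeff_def e0 e1 e2 P_def[symmetric] r[symmetric] r_def[symmetric]
      F_def[symmetric] G_def[symmetric] x_def by simp
  have "(\<Prod>n = 1..m. qv ^ (2 * n) + qv powi (- 2 * int a))
      = (\<Prod>i<m. qv ^ (2 * Suc i) * (1 + r ^ (a + Suc i)))"
  proof (rule prod.reindex_bij_witness[of _ Suc "\<lambda>n. n - 1"])
    fix n assume "n \<in> {1..m}"
    then have n: "Suc (n - 1) = n" by auto
    have "qv ^ (2 * n) * r ^ (a + n) = qv powi (int (2 * n) + - 2 * int (a + n))"
      unfolding r qv_powi_add power_int_of_nat ..
    also have "int (2 * n) + - 2 * int (a + n) = - 2 * int a" by simp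
    finally show "qv ^ (2 * Suc (n - 1)) * (1 + r ^ (a + Suc (n - 1)))
        = qv ^ (2 * n) + qv powi (- 2 * int a)"
      unfolding n by (simp only: distrib_left mult_1_right)
  qed auto
  also have "\<dots> = (\<Prod>i<m. qv ^ (2 * Suc i)) * Pp"
    unfolding Pp_def by (rule prod.distrib)
  also have "(\<Prod>i<m. qv ^ (2 * Suc i)) = qv powi (int m * (int m + 1))"
  proof (induction m)
    case (Suc m)
    have "(\<Prod>i<Suc m. qv ^ (2 * Suc i)) = qv powi (int m * (int m + 1) + int (2 * Suc m))"
      unfolding qv_powi_add Suc[symmetric] power_int_of_nat prod.lessThan_Suc ..
    also have "int m * (int m + 1) + int (2 * Suc m) = int (Suc m) * (int (Suc m) + 1)"
      by (simp add: algebra_simps)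
    finally show ?case .
  qed simp
  finally have num: "(\<Prod>n = 1..m. qv ^ (2 * n) + qv powi (- 2 * int a))
      = qv powi (int m * (int m + 1)) * Pp" .
  have "qv ^ (2 * m) * x = qv powi (int (2 * m) + - 2 * int (m + a))"
    unfolding x_def r qv_powi_add power_int_of_nat ..
  also have "int (2 * m) + - 2 * int (m + a) = - 2 * int a" by simp
  finally have d1: "qv ^ (2 * m) - qv powi (- 2 * int a) = qv powi (2 * int m) * (1 - x)"
    by (simp add: algebra_simps power_int_mult power_mult)
  \<comment> \<open>Indices below a have negative exponents and form a q-Pochhammer symbol in base
    q^{-2}; those above a form one in base q^2.\<close>
  have split: "{0..m} - {a} = {..<a} \<union> {a<..m}" using assms by auto
  have "(\<Prod>n\<in>{0..m} - {a}. 1 - qv powi (2 * int n - 2 * int a))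
      = (\<Prod>n<a. 1 - qv powi (2 * int n - 2 * int a))
        * (\<Prod>n\<in>{a<..m}. 1 - qv powi (2 * int n - 2 * int a))"
    unfolding split by (rule prod.union_disjoint) auto
  also have "(\<Prod>n<a. 1 - qv powi (2 * int n - 2 * int a)) = G a"
    unfolding G_def qpoch_def r
    by (rule prod.reindex_bij_witness[of _ "\<lambda>i. a - Suc i" "\<lambda>n. a - Suc n"])
       (auto simp: of_nat_diff algebra_simps)
  also have "(\<Prod>n\<in>{a<..m}. 1 - qv powi (2 * int n - 2 * int a)) = F (m - a)"
    unfolding F_def qpoch_def
  proof (rule prod.reindex_bij_witness[of _ "\<lambda>i. a + Suc i" "\<lambda>n. n - Suc a"])
    fix n assume "n \<in> {a<..m}"
    then have "2 * int n - 2 * int a = int (2 * Suc (n - Suc a))" by auto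
    then have "qv powi (2 * int n - 2 * int a) = (qv ^ 2) ^ Suc (n - Suc a)"
      by (simp only: power_int_of_nat power_mult)
    then show "1 - (qv ^ 2) ^ Suc (n - Suc a) = 1 - qv powi (2 * int n - 2 * int a)" by simp
  qed auto
  finally have d2: "(\<Prod>n\<in>{0..m} - {a}. 1 - qv powi (2 * int n - 2 * int a)) = G a * F (m - a)" .
  have e: "qv powi (int m - 2 * int a) * qv powi (int m * (int m + 1))
      = qv powi (int m * int m - 2 * int a) * qv powi (2 * int m)"
    unfolding qv_powi_add[symmetric]
    by (rule arg_cong[of _ _ "\<lambda>n. qv powi n"]) (simp add: algebra_simps)
  have "coeffA m a = qdfact_odd m * (qv powi (int m - 2 * int a) * qv powi (int m * (int m + 1)))
      * Pp / (qv powi (2 * int m) * ((1 - x) * (G a * F (m - a))))"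
    unfolding coeffA_def num d1 d2 by (simp add: mult_ac)
  also have "\<dots> = correlator_coeff m (m + a)"
    unfolding e L key by simp
  finally show ?thesis ..
qed

theorem mainTheorem2:
  fixes m N :: nat and E :: "symfun \<Rightarrow> ratfun"
  assumes "m \<ge> 1"
    and "is_q_gaussian_average N E"
  shows "E (powersum (2 * m)) =
    qv powi (- 2 * int N * int m) * coeffB m
      + (\<Sum>a = 0..m. qv ^ (2 * N * a) * coeffA m a)"
proof -
  define f where "f j = correlator_coeff m j * qv powi (2 * int N * (int j - int m))" for j
  have f: "f j = 0" if "j \<in> {1..<m}" for j
    using correlator_coeff_eq_0[of j m] that by (simp add: f_def)
  have "E (powersum (2 * m)) = (\<Sum>j\<le>2 * m. f j)"
    unfolding f_def using assms by (simp add: q_gaussian_powersum_even_expand)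
  \<comment> \<open>The indices 1, ..., m - 1 drop out. Since m >= 1, index 0 lies outside m, ...,
    2m and contributes a separate term.\<close>
  also have "\<dots> = (\<Sum>j\<in>insert 0 {m..2 * m}. f j)"
    by (intro sum.mono_neutral_right) (auto intro!: f)
  also have "\<dots> = f 0 + (\<Sum>j\<in>{m..2 * m}. f j)"
    using assms by (subst sum.insert) auto
  also have "(\<Sum>j\<in>{m..2 * m}. f j) = (\<Sum>a = 0..m. f (m + a))"
    by (rule sum.reindex_bij_witness[of _ "\<lambda>a. m + a" "\<lambda>j. j - m"]) auto
  also have "\<dots> = (\<Sum>a = 0..m. qv ^ (2 * N * a) * coeffA m a)"
  proof (rule sum.cong[OF refl])
    fix a assume "a \<in> {0..m}"
    then have "correlator_coeff m (m + a) = coeffA m a"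
      using assms by (intro correlator_coeff_add) auto
    moreover have "qv powi (2 * int N * (int (m + a) - int m)) = qv powi (int (2 * N * a))"
      by simp
    ultimately show "f (m + a) = qv ^ (2 * N * a) * coeffA m a"
      unfolding f_def power_int_of_nat by simp
  qed
  also have "f 0 = qv powi (- 2 * int N * int m) * coeffB m"
    using assms by (simp add: f_def correlator_coeff_0)
  finally show ?thesis .
qed

end
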